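(* Let $n$ and $r$ be integers with $1\leq r\leq \frac{n}{2}-1$, and let $T$ be a tree on $n$ vertices with exactly $r$ branching vertices. Then $\xi^{ce}(T)\geq \xi^{ce}(F(n,r))$, with equality if and only if $T\cong F(n,r)$.
   Context: A branching vertex of a tree is a vertex of degree at least $3$. For a vertex $x$ of a connected graph $H$, $d_H(x)$ is its degree and $\varepsilon_H(x)$ its eccentricity (maximum distance from $x$ to any vertex); $\xi^{ce}(H)=\sum_{x\in V(H)}\frac{d_H(x)}{\varepsilon_H(x)}$. $F(n,r)$ is the greedy caterpillar with degree sequence consisting of $r$ entries $3$, $n-2r-2$ entries $2$ and $r+2$ entries $1$. Greedy caterpillar for a non-increasing tree degree sequence $(d_1,\dots,d_n)$ with $d_k>1$, $d_{k+1}=1$: take a path $P=z_1\cdots z_k$, a bijection $\phi$ from $\{z_1,\dots,z_k\}$ onto the entries $d_1,\dots,d_k$ such that $\varepsilon_P(z_i)>\varepsilon_P(z_j)$ implies $\phi(z_i)\geq\phi(z_j)$; attach $\phi(z_i)-2$ pendant vertices to $z_i$ for $2\leq i\leq k-1$ and $\phi(z_i)-1$ pendant vertices to $z_i$ for $i\in\{1,k\}$. *)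

theory Defs
  imports Complex_Main "Graph_Theory.Graph_Theory"
begin

text \<open>
  Finite simple graphs are the \<open>pair_graph\<close>s of the session Graph-Theory: finite, loop-free,
  symmetric sets of ordered pairs. An undirected edge is represented by two opposite arcs, so the
  degree of a vertex is its out-degree.
\<close>

abbreviation gdegree :: "'a pair_pre_digraph \<Rightarrow> 'a \<Rightarrow> nat" where
  "gdegree G x \<equiv> out_degree (with_proj G) x"

abbreviation giso :: "'a pair_pre_digraph \<Rightarrow> 'b pair_pre_digraph \<Rightarrow> bool" where
  "giso G H \<equiv> digraph_iso (with_proj G) (with_proj H)"

text \<open>
  The predicate \<open>tree\<close> of the library cannot be used: in a symmetric digraph every edge gives a
  directed cycle of length 2. In a loop-free symmetric digraph the directed cycles of length at
  least 3 are exactly the two orientations of the cycles of the undirected graph.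
\<close>

definition undirected_tree :: "'a pair_pre_digraph \<Rightarrow> bool" where
  "undirected_tree T \<longleftrightarrow>
     pair_graph T \<and> connected (with_proj T) \<and>
     \<not> (\<exists>p. pre_digraph.cycle (with_proj T) p \<and> 3 \<le> length p)"

definition branching_vertices :: "'a pair_pre_digraph \<Rightarrow> 'a set" where
  "branching_vertices T = {x \<in> pverts T. 3 \<le> gdegree T x}"

text \<open>Distance and eccentricity; meaningful for finite connected graphs only.\<close>

definition gdist :: "'a pair_pre_digraph \<Rightarrow> 'a \<Rightarrow> 'a \<Rightarrow> nat" where
  "gdist G x y = (LEAST l. \<exists>p. pre_digraph.awalk (with_proj G) x p y \<and> length p = l)"

definition ecc :: "'a pair_pre_digraph \<Rightarrow> 'a \<Rightarrow> nat" where
  "ecc G x = Max (gdist G x ` pverts G)"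

definition xi_ce :: "'a pair_pre_digraph \<Rightarrow> real" where
  "xi_ce G = (\<Sum>x\<in>pverts G. real (gdegree G x) / real (ecc G x))"

definition path_graph :: "nat \<Rightarrow> nat pair_pre_digraph" where
  "path_graph k =
     \<lparr> pverts = {1..k},
       parcs = {(i, j). i \<in> {1..k} \<and> j \<in> {1..k} \<and> (j = Suc i \<or> i = Suc j)} \<rparr>"

text \<open>
  Attach \<open>m v\<close> pendant vertices to each vertex \<open>v\<close> of \<open>P\<close>. The vertex \<open>(v, 0)\<close> is the
  copy of \<open>v\<close>, and \<open>(v, 1), \<dots>, (v, m v)\<close> are the pendant vertices attached to it.
\<close>

definition attach_pendants :: "'a pair_pre_digraph \<Rightarrow> ('a \<Rightarrow> nat) \<Rightarrow> ('a \<times> nat) pair_pre_digraph" where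
  "attach_pendants P m =
     \<lparr> pverts = {(v, j). v \<in> pverts P \<and> j \<le> m v},
       parcs = {((u, 0), (v, 0)) | u v. (u, v) \<in> parcs P}
             \<union> {((v, 0), (v, j)) | v j. v \<in> pverts P \<and> 1 \<le> j \<and> j \<le> m v}
             \<union> {((v, j), (v, 0)) | v j. v \<in> pverts P \<and> 1 \<le> j \<and> j \<le> m v} \<rparr>"

text \<open>
  A degree sequence is a non-increasing list, so its entries greater than 1 are the first
  \<open>num_inner ds\<close> ones. Entries may be repeated; hence a bijection from the path vertices onto
  these entries is a bijection \<open>\<sigma>\<close> onto their positions, the entry assigned to the path vertex
  \<open>i\<close> being \<open>ds ! \<sigma> i\<close>.
\<close>

definition num_inner :: "nat list \<Rightarrow> nat" where
  "num_inner ds = length (filter (\<lambda>d. d > 1) ds)"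

definition greedy_assignment :: "nat list \<Rightarrow> (nat \<Rightarrow> nat) \<Rightarrow> bool" where
  "greedy_assignment ds \<sigma> \<longleftrightarrow>
     (let k = num_inner ds in
        bij_betw \<sigma> {1..k} {..<k} \<and>
        (\<forall>i\<in>{1..k}. \<forall>j\<in>{1..k}.
           ecc (path_graph k) i > ecc (path_graph k) j \<longrightarrow> ds ! \<sigma> i \<ge> ds ! \<sigma> j))"

text \<open>
  In the usual description an end of the path with entry \<open>d\<close> receives \<open>d - 1\<close> pendant vertices
  and an interior vertex \<open>d - 2\<close>. If the path has a single vertex, that vertex has no neighbour on
  the path and must receive \<open>d\<close> pendant vertices to have degree \<open>d\<close>; the caterpillar is a star.
\<close>

definition num_pendants :: "nat \<Rightarrow> (nat \<Rightarrow> nat) \<Rightarrow> nat \<Rightarrow> nat" where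
  "num_pendants k \<phi> i =
     (if k = 1 then \<phi> i else if i = 1 \<or> i = k then \<phi> i - 1 else \<phi> i - 2)"

definition greedy_caterpillar :: "nat list \<Rightarrow> (nat \<times> nat) pair_pre_digraph \<Rightarrow> bool" where
  "greedy_caterpillar ds C \<longleftrightarrow>
     (\<exists>\<sigma>. greedy_assignment ds \<sigma> \<and>
          C = attach_pendants (path_graph (num_inner ds))
                (num_pendants (num_inner ds) (\<lambda>i. ds ! \<sigma> i)))"

definition F_degrees :: "nat \<Rightarrow> nat \<Rightarrow> nat list" where
  "F_degrees n r = replicate r 3 @ replicate (n - 2 * r - 2) 2 @ replicate (r + 2) 1"

text \<open>
  The graph \<open>F(n,r)\<close> is determined up to isomorphism only; \<open>is_F n r\<close> holds for every graph
  that arises from an admissible assignment. The lemma shows that there always is one.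
\<close>

definition is_F :: "nat \<Rightarrow> nat \<Rightarrow> (nat \<times> nat) pair_pre_digraph \<Rightarrow> bool" where
  "is_F n r C \<longleftrightarrow> greedy_caterpillar (F_degrees n r) C"

lemma greedy_caterpillar_exists:
  assumes "sorted_wrt (\<ge>) ds"
  shows "\<exists>C. greedy_caterpillar ds C"
proof -
  define k where "k = num_inner ds"
  define e where "e = ecc (path_graph k)"
  define xs where "xs = rev (sort_key e [1..<Suc k])"
  have xs: "distinct xs" "set xs = {1..k}" "length xs = k"
    by (auto simp: xs_def)
  have bij: "bij_betw ((!) xs) {..<k} {1..k}"
    using bij_betw_nth[OF xs(1), of "{..<k}" "{1..k}"] xs by simp
  define s where "s = the_inv_into {..<k} ((!) xs)"
  have s: "bij_betw s {1..k} {..<k}"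
    unfolding s_def by (rule bij_betw_the_inv_into[OF bij])
  have sx: "xs ! s i = i" if "i \<in> {1..k}" for i
    unfolding s_def using bij that by (auto simp: bij_betw_def f_the_inv_into_f)
  have mono: "e (xs ! a) \<ge> e (xs ! b)" if "a \<le> b" "b < k" for a b
  proof -
    have "sorted (map e (rev xs))" by (simp add: xs_def)
    then have "sorted_wrt (\<ge>) (map e xs)"
      by (simp add: rev_map[symmetric] sorted_wrt_rev)
    then show ?thesis
      using that xs(3) by (cases "a = b") (auto simp: sorted_wrt_iff_nth_less)
  qed
  have kle: "k \<le> length ds" by (simp add: k_def num_inner_def)
  have "ds ! s i \<ge> ds ! s j" if "i \<in> {1..k}" "j \<in> {1..k}" "e i > e j" for i j
  proof -
    have "s i < k" "s j < k" using s that(1,2) by (auto simp: bij_betw_def)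
    moreover have "s i < s j"
      using mono[of "s j" "s i"] that sx[of i] sx[of j] \<open>s i < k\<close> by (force simp: not_less)
    ultimately show ?thesis
      using assms kle by (auto simp: sorted_wrt_iff_nth_less)
  qed
  then have "greedy_assignment ds s"
    using s by (simp add: greedy_assignment_def Let_def e_def k_def)
  then show ?thesis by (auto simp: greedy_caterpillar_def)
qed

lemma is_F_exists: "\<exists>C. is_F n r C"
proof -
  have rep: "sorted_wrt (\<ge>) (replicate m x)" for m and x :: nat
    by (auto simp: sorted_wrt_iff_nth_less)
  show ?thesis
    unfolding is_F_def F_degrees_def
    by (rule greedy_caterpillar_exists) (auto simp add: sorted_wrt_append rep simp del: replicate_add replicate_Suc)
qed

end

theory Submission
  imports Defs
begin

text \<open>
  The vertices of eccentricity at most \<open>j\<close> form a subtree \<open>A\<^sub>j\<close> of \<open>T\<close>, and every vertex of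
  \<open>A\<^sub>j\<^sub>+\<^sub>1\<close> lies in \<open>A\<^sub>j\<close> or is adjacent to it. Counting edges, the degrees over a nonempty
  \<open>A\<^sub>j\<close> sum to at least \<open>|A\<^sub>j| + |A\<^sub>j\<^sub>+\<^sub>1| - 2\<close>, with equality for \<open>F(n,r)\<close>. Summation by parts writes
  \<open>\<xi>\<^sup>c\<^sup>e\<close> as a positive combination of these degree sums, so it suffices to minimise every \<open>|A\<^sub>j|\<close>.

  Let \<open>D\<close> be the diameter and \<open>k = n - r - 2\<close>. Since \<open>T\<close> has at least \<open>r + 2\<close> leaves, it has at most \<open>k\<close>
  inner vertices, whence \<open>D \<le> k + 1\<close>. A diametral path meets \<open>A\<^sub>j\<close> in \<open>2j + 1 - D\<close> vertices, and each
  branching vertex in \<open>A\<^sub>j\<^sub>-\<^sub>1\<close> adds a neighbour in \<open>A\<^sub>j\<close> off the path. At most \<open>k - (2j - 1 - D)\<close>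
  branching vertices lie outside \<open>A\<^sub>j\<^sub>-\<^sub>1\<close>, and the resulting lower bound for \<open>|A\<^sub>j|\<close> is attained by \<open>F(n,r)\<close>.

  Equality forces \<open>D = k + 1\<close>, so that \<open>T\<close> is a caterpillar with inner degrees 2 and 3, and it forces
  the number of branching vertices of each eccentricity. The greedy condition leaves at most one pair
  of opposite spine vertices of different degrees, hence \<open>T\<close> is \<open>F(n,r)\<close> or its mirror image.
\<close>

section \<open>Distances, isomorphisms and the metric of a tree\<close>

text \<open>Relational powers keep the end points of a walk and forget its arcs, so distances become
  statements about \<open>parcs G ^^ l\<close>. Membership of \<open>x\<close> matters for
  \<open>l = 0\<close>, where the empty walk must start at a vertex.\<close>

lemma walk_relpow:
  assumes "pair_wf_digraph G"
  shows "(\<exists>p. pre_digraph.awalk (with_proj G) x p y \<and> length p = l)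
         \<longleftrightarrow> x \<in> pverts G \<and> (x, y) \<in> parcs G ^^ l"
proof -
  interpret pair_wf_digraph G by fact
  show ?thesis
  proof (induction l arbitrary: x)
    case 0
    then show ?case by (auto simp: awalk_Nil_iff)
  next
    case (Suc l)
    have "(\<exists>p. awalk x p y \<and> length p = Suc l) \<longleftrightarrow>
          (\<exists>z. (x, z) \<in> parcs G \<and> (\<exists>p. awalk z p y \<and> length p = l))" (is "?L \<longleftrightarrow> ?R")
    proof
      assume ?L
      then obtain e p where "awalk x (e # p) y" "length p = l"
        by (metis length_Suc_conv)
      then show ?R by (cases e) (auto simp: awalk_Cons_iff)
    next
      assume ?R
      then obtain z p where "(x, z) \<in> parcs G" "awalk z p y" "length p = l" by blast
      then have "awalk x ((x, z) # p) y \<and> length ((x, z) # p) = Suc l"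
        by (auto simp: awalk_Cons_iff)
      then show ?L by blast
    qed
    also have "\<dots> \<longleftrightarrow> (\<exists>z. (x, z) \<in> parcs G \<and> (z, y) \<in> parcs G ^^ l)"
      using Suc.IH wellformed'(2) by blast
    also have "\<dots> \<longleftrightarrow> x \<in> pverts G \<and> (x, y) \<in> parcs G ^^ Suc l"
      using wellformed'(1) by (metis relpow_Suc_D2 relpow_Suc_I2)
    finally show ?case .
  qed
qed

lemma gdist_relpow:
  assumes "pair_wf_digraph G" "x \<in> pverts G"
  shows "gdist G x y = (LEAST l. (x, y) \<in> parcs G ^^ l)"
  unfolding gdist_def walk_relpow[OF assms(1)] using assms(2) by simp

lemma gdegree_card: "gdegree G x = card {y. (x, y) \<in> parcs G}"
proof -
  have "out_arcs (with_proj G) x = Pair x ` {y. (x, y) \<in> parcs G}"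
    by (auto simp: out_arcs_def)
  then show ?thesis
    by (simp add: out_degree_def card_image inj_on_def)
qed

text \<open>Certificate for a distance function: \<open>lip\<close> makes every walk from
  \<open>z\<close> to \<open>y\<close> at least \<open>h z\<close> long, and following
  \<open>step\<close> builds one of exactly that length. It yields the distances in paths and
  caterpillars.\<close>

lemma gdist_eqI:
  assumes wf: "pair_wf_digraph G" and x: "x \<in> pverts G"
    and zero: "\<And>z. z \<in> pverts G \<Longrightarrow> h z = 0 \<longleftrightarrow> z = y"
    and lip: "\<And>u v. (u, v) \<in> parcs G \<Longrightarrow> h u \<le> Suc (h v)"
    and step: "\<And>z. z \<in> pverts G \<Longrightarrow> z \<noteq> y \<Longrightarrow> \<exists>u. (z, u) \<in> parcs G \<and> h z = Suc (h u)"
  shows "gdist G x y = h x"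
proof -
  interpret pair_wf_digraph G by fact
  have lower: "y \<in> pverts G \<Longrightarrow> (z, y) \<in> parcs G ^^ l \<Longrightarrow> h z \<le> l" for z l
  proof (induction l arbitrary: z)
    case 0
    then show ?case using zero by simp
  next
    case (Suc l)
    from Suc.prems(2) obtain u where "(z, u) \<in> parcs G" "(u, y) \<in> parcs G ^^ l"
      by (meson relpow_Suc_D2)
    then show ?case using lip[of z u] Suc.IH[of u] Suc.prems(1) by simp
  qed
  have upper: "z \<in> pverts G \<Longrightarrow> (z, y) \<in> parcs G ^^ h z" for z
  proof (induction "h z" arbitrary: z)
    case 0
    then have "h z = 0" "z = y" using zero[of z] by auto
    then show ?case by simp
  next
    case (Suc n)
    then have "z \<noteq> y" using zero by force
    then obtain u where u: "(z, u) \<in> parcs G" "h z = Suc (h u)" using step Suc by blast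
    then have "(u, y) \<in> parcs G ^^ h u" using Suc wellformed' by auto
    then show ?case using u by (metis relpow_Suc_I2)
  qed
  have "y \<in> pverts G"
    using upper[OF x] x wellformed'(2) by (cases "h x") auto
  then show ?thesis
    unfolding gdist_relpow[OF wf x]
    using lower upper[OF x] by (intro Least_equality) auto
qed

text \<open>A \<open>digraph_iso\<close> carries separate arc, head and tail maps. Since arcs are
  ordered pairs, the arc map acts as \<open>map_prod f f\<close>, and the new head and tail maps are
  \<open>snd\<close> and \<open>fst\<close>.\<close>

lemma giso_iff:
  assumes "pair_wf_digraph G" "pair_wf_digraph H"
  shows "giso G H \<longleftrightarrow> (\<exists>f. bij_betw f (pverts G) (pverts H) \<and>
     (\<forall>u\<in>pverts G. \<forall>v\<in>pverts G. (u, v) \<in> parcs G \<longleftrightarrow> (f u, f v) \<in> parcs H))" (is "?L \<longleftrightarrow> ?R")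
proof
  interpret G: pair_wf_digraph G by fact
  assume ?L
  then obtain h where h: "pre_digraph.digraph_isomorphism (with_proj G) h"
    and H: "with_proj H = app_iso h (with_proj G)"
    unfolding digraph_iso_def by blast
  have pv: "pverts H = iso_verts h ` pverts G"
    and pa: "parcs H = iso_arcs h ` parcs G" and t: "iso_tail h = fst" and hd: "iso_head h = snd"
    using H by (auto simp: with_proj_def app_iso_def)
  have inj: "inj_on (iso_verts h) (pverts G)"
    using h by (simp add: G.digraph_isomorphism_def)
  have arc: "iso_arcs h (u, v) = (iso_verts h u, iso_verts h v)" if "(u, v) \<in> parcs G" for u v
    using h that t hd unfolding G.digraph_isomorphism_def by (auto simp: prod_eq_iff)
  have "(u, v) \<in> parcs G \<longleftrightarrow> (iso_verts h u, iso_verts h v) \<in> parcs H"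
    if uv: "u \<in> pverts G" "v \<in> pverts G" for u v
  proof
    assume "(u, v) \<in> parcs G"
    then have "iso_arcs h (u, v) \<in> parcs H" unfolding pa by (rule imageI)
    then show "(iso_verts h u, iso_verts h v) \<in> parcs H"
      using arc[OF \<open>(u, v) \<in> parcs G\<close>] by simp
  next
    assume "(iso_verts h u, iso_verts h v) \<in> parcs H"
    then obtain a b where ab: "(a, b) \<in> parcs G"
      "(iso_verts h u, iso_verts h v) = iso_arcs h (a, b)"
      unfolding pa by auto
    then have "iso_verts h u = iso_verts h a" "iso_verts h v = iso_verts h b"
      using arc[OF ab(1)] by auto
    then have "u = a" "v = b"
      using inj_onD[OF inj] uv G.wellformed'[OF ab(1)] by blast+
    then show "(u, v) \<in> parcs G" using ab by simp
  qed
  moreover have "bij_betw (iso_verts h) (pverts G) (pverts H)"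
    using inj pv by (simp add: bij_betw_def)
  ultimately show ?R by blast
next
  interpret G: pair_wf_digraph G by fact
  interpret H: pair_wf_digraph H by fact
  assume ?R
  then obtain f where f: "bij_betw f (pverts G) (pverts H)"
    and adj: "\<And>u v. u \<in> pverts G \<Longrightarrow> v \<in> pverts G \<Longrightarrow> (u, v) \<in> parcs G \<longleftrightarrow> (f u, f v) \<in> parcs H"
    by blast
  define h :: "('a, 'a \<times> 'a, 'b, 'b \<times> 'b) digraph_isomorphism" where
    "h = \<lparr>iso_verts = f, iso_arcs = map_prod f f, iso_head = snd, iso_tail = fst\<rparr>"
  have "parcs G \<subseteq> pverts G \<times> pverts G" using G.wellformed' by auto
  moreover have "inj_on (map_prod f f) (pverts G \<times> pverts G)"
    using f by (auto simp: bij_betw_def intro: map_prod_inj_on)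
  ultimately have "inj_on (map_prod f f) (parcs G)" by (rule inj_on_subset[rotated])
  then have "pre_digraph.digraph_isomorphism (with_proj G) h"
    using f G.wf_digraph_axioms unfolding G.digraph_isomorphism_def
    by (auto simp: h_def bij_betw_def)
  moreover have "map_prod f f ` parcs G = parcs H"
  proof (intro set_eqI iffI)
    fix e assume "e \<in> map_prod f f ` parcs G"
    then obtain u v where "(u, v) \<in> parcs G" "e = (f u, f v)" by auto
    then show "e \<in> parcs H" using adj[OF G.wellformed'] by blast
  next
    fix e assume e: "e \<in> parcs H"
    obtain x y where xy: "e = (x, y)" by fastforce
    then obtain u v where "u \<in> pverts G" "v \<in> pverts G" "x = f u" "y = f v"
      using e f H.wellformed' unfolding bij_betw_def by blast
    then have "(u, v) \<in> parcs G" "e = map_prod f f (u, v)" using adj e xy by auto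
    then show "e \<in> map_prod f f ` parcs G" by blast
  qed
  then have "with_proj H = app_iso h (with_proj G)"
    using f by (simp add: with_proj_def app_iso_def h_def bij_betw_def)
  ultimately show ?L unfolding digraph_iso_def by blast
qed

text \<open>The bijection carries neighbourhoods to neighbourhoods and, by induction on the length,
  walks to walks.\<close>

lemma giso_invariants:
  assumes G: "pair_wf_digraph G" and H: "pair_wf_digraph H"
    and f: "bij_betw f (pverts G) (pverts H)"
    and adj: "\<And>u v. u \<in> pverts G \<Longrightarrow> v \<in> pverts G \<Longrightarrow> (u, v) \<in> parcs G \<longleftrightarrow> (f u, f v) \<in> parcs H"
    and u: "u \<in> pverts G"
  shows "gdegree H (f u) = gdegree G u" and "ecc H (f u) = ecc G u"
proof -
  interpret G: pair_wf_digraph G by fact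
  interpret H: pair_wf_digraph H by fact
  have "{y. (f u, y) \<in> parcs H} = f ` {y. (u, y) \<in> parcs G}"
  proof (intro set_eqI iffI)
    fix y assume y: "y \<in> {y. (f u, y) \<in> parcs H}"
    then obtain v where "v \<in> pverts G" "y = f v"
      using f H.wellformed' unfolding bij_betw_def by blast
    then show "y \<in> f ` {y. (u, y) \<in> parcs G}" using adj[OF u] y by auto
  next
    fix y assume "y \<in> f ` {y. (u, y) \<in> parcs G}"
    then obtain v where "(u, v) \<in> parcs G" "y = f v" by blast
    then show "y \<in> {y. (f u, y) \<in> parcs H}" using adj[OF u G.wellformed'(2)] by blast
  qed
  moreover have "inj_on f {y. (u, y) \<in> parcs G}"
    using f G.wellformed' by (auto simp: bij_betw_def intro: inj_on_subset)
  ultimately show "gdegree H (f u) = gdegree G u"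
    by (simp add: gdegree_card card_image)
  have im: "pverts H = f ` pverts G" using f by (simp add: bij_betw_def)
  have pow: "(f u, f v) \<in> parcs H ^^ l \<longleftrightarrow> (u, v) \<in> parcs G ^^ l"
    if "u \<in> pverts G" "v \<in> pverts G" for u v l
    using that
  proof (induction l arbitrary: u)
    case 0
    then show ?case using f by (auto simp: bij_betw_def inj_on_def)
  next
    case (Suc l)
    have "(f u, f v) \<in> parcs H ^^ Suc l \<longleftrightarrow>
        (\<exists>z\<in>pverts H. (f u, z) \<in> parcs H \<and> (z, f v) \<in> parcs H ^^ l)"
      using H.wellformed'(2) by (metis relpow_Suc_D2 relpow_Suc_I2)
    also have "\<dots> \<longleftrightarrow> (\<exists>z\<in>pverts G. (f u, f z) \<in> parcs H \<and> (f z, f v) \<in> parcs H ^^ l)"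
      unfolding im by simp
    also have "\<dots> \<longleftrightarrow> (\<exists>z\<in>pverts G. (u, z) \<in> parcs G \<and> (z, v) \<in> parcs G ^^ l)"
      using Suc adj by blast
    also have "\<dots> \<longleftrightarrow> (u, v) \<in> parcs G ^^ Suc l"
      using G.wellformed'(2) by (metis relpow_Suc_D2 relpow_Suc_I2)
    finally show ?case .
  qed
  have "gdist H (f u) (f v) = gdist G u v" if "v \<in> pverts G" for v
  proof -
    have "f u \<in> pverts H" using f u by (auto simp: bij_betw_def)
    then show ?thesis
      unfolding gdist_relpow[OF G u] gdist_relpow[OF H] using pow[OF u that] by (simp add: gdist_relpow[OF H])
  qed
  then show "ecc H (f u) = ecc G u"
    by (simp add: ecc_def im image_image cong: image_cong)
qed

text \<open>The weight \<open>w\<close> is arbitrary so that one statement covers both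
  \<open>xi_ce\<close> and the sizes of eccentricity levels.\<close>

lemma sum_with_ecc_giso:
  assumes "pair_wf_digraph G" "pair_wf_digraph H" "giso G H"
  shows "(\<Sum>x\<in>pverts G. w (gdegree G x) (ecc G x)) = (\<Sum>x\<in>pverts H. w (gdegree H x) (ecc H x))"
proof -
  obtain f where f: "bij_betw f (pverts G) (pverts H)"
    "\<And>u v. u \<in> pverts G \<Longrightarrow> v \<in> pverts G \<Longrightarrow> (u, v) \<in> parcs G \<longleftrightarrow> (f u, f v) \<in> parcs H"
    using assms giso_iff by metis
  show ?thesis
    using sum.reindex_bij_betw[OF f(1), symmetric, where g="\<lambda>x. w (gdegree H x) (ecc H x)"]
      giso_invariants[OF assms(1,2) f]
    by simp
qed

text \<open>The edge-cut axiom says that removing an edge separates the vertices closer to one end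
  from those closer to the other.\<close>

locale metric_tree =
  fixes V :: "'a set" and E :: "('a \<times> 'a) set" and d :: "'a \<Rightarrow> 'a \<Rightarrow> nat"
  assumes finite_V: "finite V" and V_ne: "V \<noteq> {}"
    and arcs: "(u, v) \<in> E \<Longrightarrow> u \<in> V \<and> v \<in> V" and sym_E: "(u, v) \<in> E \<Longrightarrow> (v, u) \<in> E"
    and d_self: "x \<in> V \<Longrightarrow> d x x = 0"
    and d_eq0: "x \<in> V \<Longrightarrow> y \<in> V \<Longrightarrow> d x y = 0 \<Longrightarrow> x = y"
    and d_sym: "x \<in> V \<Longrightarrow> y \<in> V \<Longrightarrow> d x y = d y x"
    and d_tri: "x \<in> V \<Longrightarrow> y \<in> V \<Longrightarrow> z \<in> V \<Longrightarrow> d x z \<le> d x y + d y z"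
    and d_step: "x \<in> V \<Longrightarrow> y \<in> V \<Longrightarrow> x \<noteq> y \<Longrightarrow> \<exists>u. (y, u) \<in> E \<and> d x y = Suc (d x u)"
    and edge_side: "(u, v) \<in> E \<Longrightarrow> x \<in> V \<Longrightarrow> d x u = Suc (d x v) \<or> d x v = Suc (d x u)"
    and edge_cut: "(u, v) \<in> E \<Longrightarrow> x \<in> V \<Longrightarrow> y \<in> V \<Longrightarrow> d x u = Suc (d x v) \<Longrightarrow>
      d y v = Suc (d y u) \<Longrightarrow> d x y = Suc (d x v + d u y)"

text \<open>Deleting an edge separates its ends, because a path joining them in the rest would close
  to a cycle. The two components are the sides of the edge, and every walk between them uses it;
  this gives \<open>edge_side\<close> and \<open>edge_cut\<close>.\<close>

lemma undirected_tree_metric_tree: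
  assumes "undirected_tree T"
  shows "metric_tree (pverts T) (parcs T) (gdist T)"
proof -
  interpret pair_graph T using assms by (simp add: undirected_tree_def)
  have no_cycle: "\<And>p. cycle p \<Longrightarrow> length p < 3" using assms by (auto simp: undirected_tree_def not_le)
  have "connected (with_proj T)" using assms by (simp add: undirected_tree_def)
  then have sc: "strongly_connected (with_proj T)"
    by (rule symmetric_connected_imp_strongly_connected[OF sym_arcs])
  define A where "A = parcs T"
  define V where "V = pverts T"
  have AV: "\<And>u v. (u, v) \<in> A \<Longrightarrow> u \<in> V \<and> v \<in> V" using wellformed' by (auto simp: A_def V_def)
  have symA: "\<And>u v. (u, v) \<in> A \<Longrightarrow> (v, u) \<in> A" using arcs_symmetric by (auto simp: A_def)
  have ne: "V \<noteq> {}" using sc by (auto simp: strongly_connected_def V_def)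
  have conn: "\<exists>l. (x, y) \<in> A ^^ l" if "x \<in> V" "y \<in> V" for x y
  proof -
    have "x \<rightarrow>\<^sup>*\<^bsub>with_proj T\<^esub> y" using sc that by (simp add: strongly_connected_def V_def)
    then obtain p where "awalk x p y" by (auto simp: reachable_awalk)
    then show ?thesis
      using walk_relpow[OF pair_wf_digraph, of x y] by (auto simp: A_def)
  qed
  define d where "d x y = (LEAST l. (x, y) \<in> A ^^ l)" for x y
  have dgd: "gdist T x y = d x y" if "x \<in> V" for x y
    using gdist_relpow[OF pair_wf_digraph, of x y] that by (simp add: A_def V_def d_def)
  have dpow: "(x, y) \<in> A ^^ d x y" if "x \<in> V" "y \<in> V" for x y
    unfolding d_def using conn[OF that] by (rule LeastI_ex)
  have dle: "d x y \<le> l" if "(x, y) \<in> A ^^ l" for x y l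
    unfolding d_def using that by (rule Least_le)
  have powsym: "(x, y) \<in> A ^^ l \<Longrightarrow> (y, x) \<in> A ^^ l" for x y l
  proof (induction l arbitrary: y)
    case (Suc l)
    then show ?case by (meson relpow_Suc_E relpow_Suc_I2 symA)
  qed simp
  have dsym: "d x y = d y x" for x y
  proof -
    have "(x, y) \<in> A ^^ l \<longleftrightarrow> (y, x) \<in> A ^^ l" for l using powsym by blast
    then show ?thesis by (simp add: d_def)
  qed
  have dtri: "d x z \<le> d x y + d y z" if "x \<in> V" "y \<in> V" "z \<in> V" for x y z
    using dle[of x z "d x y + d y z"] relcompI[OF dpow[OF that(1,2)] dpow[OF that(2,3)]]
    by (simp add: relpow_add)
  have eq0: "d x y = 0 \<Longrightarrow> x = y" if "x \<in> V" "y \<in> V" for x y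
    using dpow[OF that] by simp
  have self: "d x x = 0" for x using dle[of x x 0] by simp
  have edge1: "d u v \<le> 1" if "(u, v) \<in> A" for u v
    using dle[of u v 1] that by simp
  have step: "\<exists>u. (y, u) \<in> A \<and> d x y = Suc (d x u)" if x: "x \<in> V" and y: "y \<in> V" and ne: "x \<noteq> y" for x y
  proof -
    obtain m where m: "d x y = Suc m" using eq0[OF x y] ne by (cases "d x y") auto
    then obtain u where u: "(x, u) \<in> A ^^ m" "(u, y) \<in> A"
      using dpow[OF x y] by auto
    have "d x u \<le> m" using dle[OF u(1)] .
    moreover have "d x y \<le> d x u + 1"
      using dtri[of x u y] edge1[OF u(2)] AV[OF u(2)] x y by simp
    ultimately show ?thesis using u symA m by (intro exI[of _ u]) auto
  qed
  have cut: "(d x u = Suc (d x v) \<or> d x v = Suc (d x u)) \<and>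
     (d x u = Suc (d x v) \<longrightarrow> d y v = Suc (d y u) \<longrightarrow> d x y = Suc (d x v + d u y))"
    if uv: "(u, v) \<in> A" and x: "x \<in> V" and y: "y \<in> V" for u v x y
  proof -
    define A' where "A' = A - {(u, v), (v, u)}"
    define G' where "G' = \<lparr>pverts = V, parcs = A'\<rparr>"
    interpret G': pair_wf_digraph G'
      using AV by unfold_locales (auto simp: G'_def A'_def)
    have symA': "\<And>a b. (a, b) \<in> A' \<Longrightarrow> (b, a) \<in> A'" using symA by (auto simp: A'_def)
    have uV: "u \<in> V" "v \<in> V" using AV uv by auto
    have unv: "u \<noteq> v" using no_loops' uv by (auto simp: A_def)
    have bridge: "(u, v) \<notin> A'\<^sup>*"
    proof
      assume "(u, v) \<in> A'\<^sup>*"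
      then obtain l where "(u, v) \<in> A' ^^ l" by (auto dest: rtrancl_imp_relpow)
      then have "\<exists>p. G'.awalk u p v"
        using walk_relpow[OF G'.pair_wf_digraph_axioms, of u v l] uV by (auto simp: G'_def)
      then obtain p where p: "G'.apath u p v"
        using G'.apath_awalk_to_apath by blast
      have tr: "G'.awalk a q b \<Longrightarrow> awalk a q b" for a q b
        unfolding G'.awalk_def awalk_def by (auto simp: G'_def A'_def A_def V_def)
      have p': "G'.awalk u p v" and pd: "distinct (pawalk_verts u p)"
        using p unfolding G'.apath_def by auto
      have pw: "awalk u p v" by (rule tr[OF p'])
      have "set p \<subseteq> parcs G'" using p' unfolding G'.awalk_def by auto
      then have pa: "set p \<subseteq> A'" by (simp add: G'_def)
      \<comment> \<open>The path \<open>p\<close> avoids the edge, so it is not the single arc from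
        \<open>u\<close> to \<open>v\<close>, and the cycle has length at least 3.\<close>
      have "cycle ((v, u) # p)"
        unfolding cycle_def using pw pd uv symA
        by (intro exI[of _ v]) (auto simp: awalk_Cons_iff A_def)
      then have "length p < 2" using no_cycle by fastforce
      then have "p = [] \<or> (\<exists>e. p = [e])" by (cases p) auto
      then show False using pw pa unv by (auto simp: awalk_simps A'_def)
    qed
    define Cu where "Cu = {z. (u, z) \<in> A'\<^sup>*}"
    define Cv where "Cv = {z. (v, z) \<in> A'\<^sup>*}"
    have disj: "Cu \<inter> Cv = {}"
    proof -
      have "sym (A'\<^sup>*)" using symA' by (intro sym_rtrancl) (auto simp: sym_def)
      then have "(z, v) \<in> A'\<^sup>*" if "(v, z) \<in> A'\<^sup>*" for z using that by (rule symD)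
      then show ?thesis using bridge unfolding Cu_def Cv_def
        by (auto intro: rtrancl_trans)
    qed
    have cover: "(u, z) \<in> A ^^ l \<Longrightarrow> z \<in> Cu \<union> Cv" for z l
    proof (induction l arbitrary: z)
      case 0
      then show ?case by (auto simp: Cu_def)
    next
      case (Suc l)
      then obtain w where w: "w \<in> Cu \<union> Cv" "(w, z) \<in> A" by (meson relpow_Suc_E)
      show ?case
      proof (cases "(w, z) \<in> A'")
        case True
        then show ?thesis using w by (auto simp: Cu_def Cv_def intro: rtrancl_into_rtrancl)
      next
        case False
        then have "z = u \<or> z = v" using w by (auto simp: A'_def)
        then show ?thesis by (auto simp: Cu_def Cv_def)
      qed
    qed
    have inC: "z \<in> Cu \<or> z \<in> Cv" if "z \<in> V" for z
      using cover conn[OF uV(1) that] by blast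
    \<comment> \<open>The tuple equation lets one induction serve both directions. A walk can leave
      \<open>Ca\<close> only by the arc \<open>(a, b)\<close>, and at least \<open>d b y\<close>
      further steps follow.\<close>
    have cross: "x \<in> V \<Longrightarrow> x \<in> Ca \<Longrightarrow> y \<in> Cb \<Longrightarrow> (x, y) \<in> A ^^ l \<Longrightarrow> Suc (d x a + d b y) \<le> l"
      if ab: "(Ca, Cb, a, b) = (Cv, Cu, v, u) \<or> (Ca, Cb, a, b) = (Cu, Cv, u, v)" for Ca Cb a b x y l
    proof (induction l arbitrary: x)
      case 0
      then show ?case using disj ab by auto
    next
      case (Suc l)
      obtain w where w: "(x, w) \<in> A" "(w, y) \<in> A ^^ l" using Suc.prems(4) by (meson relpow_Suc_D2)
      have abV: "a \<in> V" "b \<in> V" using ab uV by auto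
      show ?case
      proof (cases "(x, w) \<in> A'")
        case True
        then have "w \<in> Ca" using Suc.prems ab
          by (auto simp: Cu_def Cv_def intro: rtrancl_into_rtrancl)
        then have "Suc (d w a + d b y) \<le> l" using Suc.IH w Suc.prems AV by blast
        moreover have "d x a \<le> 1 + d w a"
          using dtri[of x w a] edge1[OF w(1)] AV[OF w(1)] abV by simp
        ultimately show ?thesis by simp
      next
        case False
        then have "(x = u \<and> w = v) \<or> (x = v \<and> w = u)" using w by (auto simp: A'_def)
        moreover have "u \<in> Cu" "v \<in> Cv" by (auto simp: Cu_def Cv_def)
        ultimately have "x = a" "w = b" using Suc.prems(2) ab disj by auto
        then show ?thesis using dle[OF w(2)] self by simp
      qed
    qed
    have exact: "d x y = Suc (d x a + d b y)"
      if ab: "(Ca, Cb, a, b) = (Cv, Cu, v, u) \<or> (Ca, Cb, a, b) = (Cu, Cv, u, v)"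
        and xy: "x \<in> V" "x \<in> Ca" "y \<in> V" "y \<in> Cb" for Ca Cb a b x y
    proof (rule antisym)
      have abV: "a \<in> V" "b \<in> V" "(a, b) \<in> A" using ab uV uv symA by auto
      show "d x y \<le> Suc (d x a + d b y)"
        using dtri[of x a y] dtri[of a b y] edge1[of a b] abV xy by simp
      show "Suc (d x a + d b y) \<le> d x y"
        using cross[OF ab xy(1,2,4) dpow[OF xy(1,3)]] .
    qed
    have uu: "u \<in> Cu" "v \<in> Cv" by (auto simp: Cu_def Cv_def)
    have v_side: "d z u = Suc (d z v)" if "z \<in> V" "z \<in> Cv" for z
      using exact[of Cv Cu v u z u] that uV uu self by simp
    have u_side: "d z v = Suc (d z u)" if "z \<in> V" "z \<in> Cu" for z
      using exact[of Cu Cv u v z v] that uV uu self by simp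
    show ?thesis
    proof (intro conjI impI)
      show "d x u = Suc (d x v) \<or> d x v = Suc (d x u)"
        using inC[OF x] v_side[OF x] u_side[OF x] by blast
    next
      assume xu: "d x u = Suc (d x v)" and yv: "d y v = Suc (d y u)"
      have "x \<in> Cv" using inC[OF x] u_side[OF x] xu by force
      moreover have "y \<in> Cu" using inC[OF y] v_side[OF y] yv by force
      ultimately show "d x y = Suc (d x v + d u y)" using exact[of Cv Cu v u x y] x y by blast
    qed
  qed
  interpret M: metric_tree V A d
  proof
    fix u v x y assume "(u, v) \<in> A" "x \<in> V" "y \<in> V"
      "d x u = Suc (d x v)" "d y v = Suc (d y u)"
    then show "d x y = Suc (d x v + d u y)" using cut[of u v x y] by blast
  next
    fix u v x assume "(u, v) \<in> A" "x \<in> V"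
    then show "d x u = Suc (d x v) \<or> d x v = Suc (d x u)" using cut[of u v x x] by blast
  next
    show "finite V" using finite_verts by (simp add: V_def)
  next
    fix x y show "d x y = d y x" by (rule dsym)
  next
    fix u v assume "(u, v) \<in> A" then show "(v, u) \<in> A" by (rule symA)
  qed (use ne self in \<open>simp_all add: AV eq0 dtri step\<close>)
  have "metric_tree V A (gdist T)"
  proof
    fix u v x y assume uv: "(u, v) \<in> A" and xy: "x \<in> V" "y \<in> V"
      and "gdist T x u = Suc (gdist T x v)" "gdist T y v = Suc (gdist T y u)"
    then show "gdist T x y = Suc (gdist T x v + gdist T u y)"
      using M.edge_cut[OF uv xy] M.arcs[OF uv] by (simp add: dgd)
  next
    fix x y assume "x \<in> V" "y \<in> V" "x \<noteq> y"
    then show "\<exists>u. (y, u) \<in> A \<and> gdist T x y = Suc (gdist T x u)"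
      using M.d_step by (simp add: dgd)
  next
    fix x y assume "x \<in> V" "y \<in> V"
    then show "gdist T x y = gdist T y x" using M.d_sym by (simp add: dgd)
  qed (simp_all add: dgd M.finite_V M.V_ne M.arcs M.sym_E M.d_self M.d_eq0 M.d_tri M.edge_side)
  then show ?thesis by (simp add: A_def V_def)
qed

section \<open>Eccentricity levels of a tree\<close>

context metric_tree
begin

definition ec :: "'a \<Rightarrow> nat" where "ec v = Max (d v ` V)"

definition deg :: "'a \<Rightarrow> nat" where "deg v = card {u. (v, u) \<in> E}"

definition level :: "nat \<Rightarrow> 'a set" where "level j = {v \<in> V. ec v \<le> j}"

text \<open>The children of \<open>v\<close> in the tree rooted at \<open>c\<close>; the root stays
  a parameter because different counts choose it differently.\<close>

definition children :: "'a \<Rightarrow> 'a \<Rightarrow> 'a set" where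
  "children c v = {w. (v, w) \<in> E \<and> d c w = Suc (d c v)}"

definition inner :: "'a set" where "inner = {v \<in> V. 2 \<le> deg v}"

definition branching :: "'a set" where "branching = {v \<in> V. 3 \<le> deg v}"

lemma d_le_ec: "v \<in> V \<Longrightarrow> w \<in> V \<Longrightarrow> d v w \<le> ec v"
  unfolding ec_def using finite_V by (intro Max_ge) auto

lemma ec_leI: "v \<in> V \<Longrightarrow> (\<And>w. w \<in> V \<Longrightarrow> d v w \<le> m) \<Longrightarrow> ec v \<le> m"
  unfolding ec_def using finite_V V_ne by (subst Max_le_iff) auto

lemma edge_dist: "(u, v) \<in> E \<Longrightarrow> d u v = 1"
  using edge_side[of u v u] arcs[of u v] d_self[of u] by auto

lemma ec_edge: "(u, v) \<in> E \<Longrightarrow> ec v \<le> Suc (ec u)"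
  using arcs[of u v] edge_dist[of v u] sym_E d_tri[of v u] d_le_ec[of u]
  by (intro ec_leI) (fastforce intro: order_trans)+

lemma finite_nbrs: "finite {u. (v, u) \<in> E}"
  by (rule finite_subset[OF _ finite_V]) (use arcs in auto)

lemma finite_children: "finite (children c v)"
  by (rule finite_subset[OF _ finite_nbrs[of v]]) (auto simp: children_def)

text \<open>If \<open>u'\<close> were on the side of \<open>v\<close> of the edge between
  \<open>v\<close> and \<open>u\<close>, its path to \<open>c\<close> would cross that edge and be
  two steps longer than the one from \<open>u\<close>. So \<open>u'\<close> is on the side of
  \<open>u\<close>, and being adjacent to \<open>v\<close> it equals \<open>u\<close>.\<close>

lemma parent_unique:
  assumes "c \<in> V" and e: "(v, u) \<in> E" "(v, u') \<in> E"
    and "d c v = Suc (d c u)" "d c v = Suc (d c u')"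
  shows "u = u'"
proof -
  have V: "u \<in> V" "u' \<in> V" "v \<in> V" using arcs e by auto
  have u'v: "d u' v = 1" using edge_dist sym_E e by blast
  from edge_side[OF sym_E[OF e(1)] V(2)] show ?thesis
  proof
    assume "d u' u = Suc (d u' v)"
    then have "d u' c = Suc (d u' v + d u c)"
      using edge_cut[OF sym_E[OF e(1)] V(2) assms(1)] assms(4) by simp
    then show ?thesis using d_sym assms V u'v by simp
  next
    assume "d u' v = Suc (d u' u)"
    then show ?thesis using u'v d_eq0 V by fastforce
  qed
qed

lemma deg_children:
  assumes c: "c \<in> V" and v: "v \<in> V"
  shows "deg v = (if v = c then 0 else 1) + card (children c v)"
proof (cases "v = c")
  case True
  have "{u. (v, u) \<in> E} = children c v"
    using edge_dist d_self[OF c] True unfolding children_def by auto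
  then show ?thesis using True by (simp add: deg_def)
next
  case False
  then obtain u where u: "(v, u) \<in> E" "d c v = Suc (d c u)" using d_step c v by blast
  have "{w. (v, w) \<in> E} = insert u (children c v)"
    using u parent_unique[OF c _ u(1) _ u(2)] edge_side[of v _ c] c unfolding children_def
    by auto
  moreover have "u \<notin> children c v" using u unfolding children_def by auto
  ultimately show ?thesis
    using False finite_children by (simp add: deg_def)
qed

lemma children_disjoint:
  assumes "c \<in> V" "w \<in> children c v" "w \<in> children c v'"
  shows "v = v'"
  using assms parent_unique[OF assms(1), of w v v'] sym_E unfolding children_def by auto

text \<open>Every vertex of \<open>X\<close> except the root \<open>c\<close> has one edge to its
  parent. The remaining edges lead to children, and distinct vertices have disjoint sets of
  children.\<close>

lemma deg_sum:
  assumes "X \<subseteq> V" "c \<in> X"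
  shows "(\<Sum>v\<in>X. deg v) + 1 = card X + card (\<Union>v\<in>X. children c v)"
proof -
  have finX: "finite X" and cV: "c \<in> V" using assms finite_V finite_subset by auto
  have "(\<Sum>v\<in>X. deg v) = (\<Sum>v\<in>X. if v = c then 0 else 1) + (\<Sum>v\<in>X. card (children c v))"
    using deg_children[OF cV] assms by (subst sum.distrib[symmetric]) (auto intro!: sum.cong)
  moreover have "(\<Sum>v\<in>X. if v = c then 0 else 1) + 1 = card X"
    using finX assms(2) card_Suc_Diff1[OF finX assms(2)] by (simp add: sum.remove[of X c])
  moreover have "card (\<Union>v\<in>X. children c v) = (\<Sum>v\<in>X. card (children c v))"
    using finX finite_children children_disjoint[OF cV] by (intro card_UN_disjoint) auto
  ultimately show ?thesis by simp
qed

lemma deg_sum_total: "(\<Sum>v\<in>V. deg v) + 2 = 2 * card V"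
proof -
  obtain c where c: "c \<in> V" using V_ne by blast
  have "(\<Union>v\<in>V. children c v) = V - {c}"
  proof (intro set_eqI iffI)
    fix w assume "w \<in> (\<Union>v\<in>V. children c v)"
    then show "w \<in> V - {c}" using arcs d_self[OF c] unfolding children_def by auto
  next
    fix w assume "w \<in> V - {c}"
    then obtain u where "(w, u) \<in> E" "d c w = Suc (d c u)" using d_step c by blast
    then show "w \<in> (\<Union>v\<in>V. children c v)"
      using sym_E arcs unfolding children_def by blast
  qed
  then show ?thesis
    using deg_sum[OF subset_refl c] finite_V c card_Suc_Diff1[OF finite_V c] by simp
qed

text \<open>With a root \<open>c\<close> in \<open>level j\<close>, the parent of every other vertex
  of \<open>level (Suc j)\<close> lies in \<open>level j\<close>, so these vertices are all among
  the children counted in \<open>deg_sum\<close>.\<close>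

lemma level_deg_sum:
  assumes "level j \<noteq> {}"
  shows "card (level j) + card (level (Suc j)) \<le> (\<Sum>v\<in>level j. deg v) + 2"
proof -
  obtain c where c: "c \<in> level j" using assms by blast
  then have cV: "c \<in> V" and ecc_c: "ec c \<le> j" by (auto simp: level_def)
  have lV: "level i \<subseteq> V" for i by (auto simp: level_def)
  have "level (Suc j) - {c} \<subseteq> (\<Union>v\<in>level j. children c v)"
  proof
    fix v assume v: "v \<in> level (Suc j) - {c}"
    then have vV: "v \<in> V" "ec v \<le> Suc j" by (auto simp: level_def)
    obtain u where u: "(v, u) \<in> E" "d c v = Suc (d c u)" using d_step cV v vV by blast
    have uV: "u \<in> V" using u arcs by blast
    \<comment> \<open>For \<open>y\<close> on the side of \<open>u\<close>, the vertex
      \<open>v\<close> is one step farther away. For \<open>y\<close> on the side of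
      \<open>v\<close>, the path from \<open>c\<close> to \<open>y\<close> passes through
      \<open>u\<close>, so \<open>d u y \<le> d c y\<close>.\<close>
    have "d u y \<le> j" if y: "y \<in> V" for y
    proof -
      from edge_side[OF u(1) y] show ?thesis
      proof
        assume "d y v = Suc (d y u)"
        then show ?thesis using d_le_ec[OF vV(1) y] vV d_sym y uV by simp
      next
        assume yu: "d y u = Suc (d y v)"
        then have "d y c = Suc (d y v + d u c)"
          using edge_cut[OF sym_E[OF u(1)] y cV] u(2)
          by (metis add.commute d_sym uV cV vV(1) y edge_cut u(1) add_Suc_right add_Suc)
        then show ?thesis using d_le_ec[OF cV y] ecc_c d_sym[OF y] uV cV yu by simp
      qed
    qed
    then have "u \<in> level j" using uV ec_leI by (simp add: level_def)
    then show "v \<in> (\<Union>v\<in>level j. children c v)"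
      using u sym_E unfolding children_def by auto
  qed
  then have "card (level (Suc j) - {c}) \<le> card (\<Union>v\<in>level j. children c v)"
    using finite_children finite_subset[OF lV finite_V] by (intro card_mono) auto
  moreover have "card (level (Suc j)) \<le> Suc (card (level (Suc j) - {c}))"
    using card_Diff_singleton_if[of "level (Suc j)" c] by (auto split: if_splits)
  ultimately show ?thesis using deg_sum[OF lV c] by simp
qed

lemma deg_pos: "v \<in> V \<Longrightarrow> 2 \<le> card V \<Longrightarrow> 1 \<le> deg v"
proof -
  assume v: "v \<in> V" "2 \<le> card V"
  then have "\<not> V \<subseteq> {v}" using card_mono[of "{v}" V] by auto
  then obtain x where "x \<in> V" "x \<noteq> v" by blast
  then obtain u where "(v, u) \<in> E" using d_step v by blast
  then show "1 \<le> deg v"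
    unfolding deg_def using finite_nbrs by (metis One_nat_def Suc_leI card_gt_0_iff empty_iff mem_Collect_eq)
qed

text \<open>The function \<open>?g\<close> bounds the degree from below by 1, 2 or 3, and the
  degrees sum to \<open>2 * card V - 2\<close>. Equality in the resulting bound forces
  \<open>deg v = ?g v\<close> at every vertex.\<close>

lemma inner_bound:
  assumes "2 \<le> card V"
  shows "card inner + card branching + 2 \<le> card V"
    and "card inner + card branching + 2 = card V \<Longrightarrow> v \<in> V \<Longrightarrow> deg v \<le> 3"
proof -
  let ?g = "\<lambda>v. 1 + (if v \<in> inner then 1 else 0) + (if v \<in> branching then 1 else 0) :: nat"
  have le: "?g v \<le> deg v" if "v \<in> V" for v
    using deg_pos[OF that assms] by (auto simp: inner_def branching_def)
  have sub: "inner \<subseteq> V" "branching \<subseteq> V" by (auto simp: inner_def branching_def)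
  have sumg: "(\<Sum>v\<in>V. ?g v) = card V + card inner + card branching"
    using sub finite_V by (simp only: sum.distrib sum.If_cases) (simp add: Int_absorb1 Int_absorb2)
  show bound: "card inner + card branching + 2 \<le> card V"
    using sum_mono[of V ?g deg, OF le] sumg deg_sum_total by simp
  assume eq: "card inner + card branching + 2 = card V" and v: "v \<in> V"
  have "?g v = deg v"
  proof (rule ccontr)
    assume "?g v \<noteq> deg v"
    then have "?g v < deg v" using le[OF v] by linarith
    then have "(\<Sum>v\<in>V. ?g v) < (\<Sum>v\<in>V. deg v)"
      using sum_strict_mono_ex1[OF finite_V, of ?g deg] le v by blast
    then show False using sumg deg_sum_total eq by simp
  qed
  then show "deg v \<le> 3" by (auto split: if_splits)
qed

end

section \<open>Geometry of a diametral path\<close>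

locale diametral_tree = metric_tree +
  fixes a b :: 'a
  assumes aV: "a \<in> V" and bV: "b \<in> V"
    and diametral: "x \<in> V \<Longrightarrow> y \<in> V \<Longrightarrow> d x y \<le> d a b"
begin

abbreviation D :: nat where "D \<equiv> d a b"

text \<open>In a tree, equality in the triangle inequality characterises the vertices of the path
  from \<open>a\<close> to \<open>b\<close>; no list of vertices has to be carried along.\<close>

definition spine :: "'a set" where "spine = {v \<in> V. d a v + d v b = D}"

text \<open>Induction along the path from \<open>v\<close> to \<open>w\<close>. If an end lies on
  the side of \<open>v\<close> of the first edge, its path to \<open>w\<close> runs through
  \<open>v\<close> and has length at most \<open>D\<close>, so \<open>w\<close> is no farther from
  \<open>v\<close> than the opposite end. If both ends lie beyond that edge, all three distances
  drop by one.\<close>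

lemma farthest_endpoint:
  assumes "v \<in> V" "w \<in> V"
  shows "d v w \<le> max (d v a) (d v b)"
  using assms(1)
proof (induction "d v w" arbitrary: v)
  case (Suc m)
  then have "w \<noteq> v" using d_self by force
  then obtain u where u: "(v, u) \<in> E" "d w v = Suc (d w u)" using d_step assms(2) Suc by blast
  have uV: "u \<in> V" using arcs u by blast
  have m: "m = d u w" using Suc u d_sym assms(2) uV by simp
  have IH: "d u w \<le> max (d u a) (d u b)" using Suc m uV by blast
  have away: "d x w = d x v + d v w" if "x \<in> V" "d x u = Suc (d x v)" for x
    using edge_cut[OF sym_E[OF u(1)] that(1) assms(2) that(2) u(2)] m Suc(2) by simp
  have across: "d x y = d x v + d v y" if "x \<in> V" "y \<in> V" "d x u = Suc (d x v)" "d y v = Suc (d y u)" for x y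
    using edge_cut[OF sym_E[OF u(1)] that] that d_sym[of y] Suc(3) uV by simp
  note sw = d_sym[OF aV Suc.prems] d_sym[OF bV Suc.prems] d_sym[OF aV uV] d_sym[OF bV uV] d_sym[OF aV bV]
  show ?case
  proof (cases "d a u = Suc (d a v)")
    case True
    have "d a w \<le> D" using diametral aV assms by blast
    moreover have "D \<le> d a v + d v b" using d_tri aV bV Suc by blast
    ultimately have "d v w \<le> d v b" using away[OF aV True] by simp
    then show ?thesis by simp
  next
    case False
    then have a': "d a v = Suc (d a u)" using edge_side[OF u(1) aV] by blast
    show ?thesis
    proof (cases "d b u = Suc (d b v)")
      case True
      have "d b w \<le> D" using diametral bV assms by blast
      then have "d v w \<le> d v a" using away[OF bV True] across[OF bV aV True a'] sw by simp
      then show ?thesis by simp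
    next
      case False
      then have "d b v = Suc (d b u)" using edge_side[OF u(1) bV] by blast
      then show ?thesis using IH a' sw m Suc(2) by simp
    qed
  qed
qed simp

lemma ec_eq: "v \<in> V \<Longrightarrow> ec v = max (d v a) (d v b)"
  using ec_leI[OF _ farthest_endpoint] d_le_ec[of v a] d_le_ec[of v b] aV bV
  by (intro antisym) auto

lemma spine_sub: "spine \<subseteq> V" by (auto simp: spine_def)

lemma ends_spine: "a \<in> spine" "b \<in> spine"
  using aV bV d_self by (auto simp: spine_def)

lemma spine_next:
  assumes "v \<in> spine" "v \<noteq> b"
  shows "\<exists>u\<in>spine. (v, u) \<in> E \<and> d a u = Suc (d a v)"
proof -
  have v: "v \<in> V" "d a v + d v b = D" using assms by (auto simp: spine_def)
  obtain u where u: "(v, u) \<in> E" "d b v = Suc (d b u)" using d_step bV v assms by blast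
  have uV: "u \<in> V" using u arcs by blast
  have "D \<le> d a u + d u b" using d_tri aV bV uV by blast
  moreover have "d a u \<le> d a v + 1" using d_tri[OF aV v(1) uV] edge_dist[OF u(1)] by simp
  ultimately have "d a u = Suc (d a v) \<and> d a u + d u b = D"
    using v u d_sym[OF bV v(1)] d_sym[OF bV uV] by simp
  then show ?thesis using u uV by (auto simp: spine_def)
qed

lemma spine_prev:
  assumes "v \<in> spine" "v \<noteq> a"
  shows "\<exists>u\<in>spine. (v, u) \<in> E \<and> d a v = Suc (d a u)"
proof -
  have v: "v \<in> V" "d a v + d v b = D" using assms by (auto simp: spine_def)
  obtain u where u: "(v, u) \<in> E" "d a v = Suc (d a u)" using d_step aV v assms by blast
  have uV: "u \<in> V" using u arcs by blast
  have "D \<le> d a u + d u b" using d_tri aV bV uV by blast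
  moreover have "d u b \<le> 1 + d v b" using d_tri[OF uV v(1) bV] edge_dist[OF sym_E[OF u(1)]] by simp
  ultimately have "d a u + d u b = D" using v u by simp
  then show ?thesis using u uV by (auto simp: spine_def)
qed

text \<open>Injectivity is proved by induction from the end \<open>b\<close>: for two vertices at
  the same distance from \<open>a\<close>, the successors coincide by the hypothesis, and then so do
  their parents in the tree rooted at \<open>a\<close>.\<close>

lemma spine_bij: "bij_betw (d a) spine {..D}"
proof -
  have inj: "v \<in> spine \<Longrightarrow> v' \<in> spine \<Longrightarrow> d a v = d a v' \<Longrightarrow> v = v'" for v v'
  proof (induction "d v b" arbitrary: v v')
    case 0
    then show ?case using d_eq0 bV by (auto simp: spine_def)
  next
    case (Suc m)
    have "v \<noteq> b" "v' \<noteq> b" using Suc d_self bV by (force simp: spine_def)+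
    obtain u where u: "u \<in> spine" "(v, u) \<in> E" "d a u = Suc (d a v)"
      using spine_next Suc \<open>v \<noteq> b\<close> by blast
    obtain u' where u': "u' \<in> spine" "(v', u') \<in> E" "d a u' = Suc (d a v')"
      using spine_next Suc \<open>v' \<noteq> b\<close> by blast
    have "m = d u b" using Suc u unfolding spine_def by simp
    then have "u = u'" using Suc u u' by simp
    then show ?case using parent_unique[OF aV] sym_E u u' Suc by metis
  qed
  have "m \<le> D \<Longrightarrow> \<exists>v\<in>spine. d a v = m" for m
  proof (induction m)
    case 0
    then show ?case using ends_spine d_self aV by auto
  next
    case (Suc m)
    then obtain v where "v \<in> spine" "d a v = m" by auto
    moreover have "v \<noteq> b" using Suc calculation by auto
    ultimately show ?case using spine_next by blast
  qed
  moreover have "d a v \<le> D" if "v \<in> spine" for v using that by (auto simp: spine_def)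
  ultimately show ?thesis using inj unfolding bij_betw_def inj_on_def by fastforce
qed

text \<open>The spine vertex at position \<open>i\<close> has eccentricity
  \<open>max i (D - i)\<close>, so the positions in \<open>level j\<close> run from
  \<open>D - j\<close> to \<open>j\<close>; truncated subtraction gives 0 when this range is
  empty.\<close>

lemma card_spine_level:
  assumes "j \<le> D"
  shows "card (spine \<inter> level j) = 2 * j + 1 - D"
proof -
  have ec: "ec v = max (d a v) (D - d a v)" if "v \<in> spine" for v
    using that ec_eq[of v] d_sym[of a v] aV unfolding spine_def by auto
  have "d a ` (spine \<inter> level j) = {i \<in> {..D}. max i (D - i) \<le> j}"
  proof -
    have "d a ` (spine \<inter> level j) = {i \<in> d a ` spine. max i (D - i) \<le> j}"
      using ec spine_sub by (auto simp: level_def)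
    then show ?thesis using spine_bij by (simp add: bij_betw_def)
  qed
  also have "\<dots> = {D - j..j}" using assms by auto
  finally have "d a ` (spine \<inter> level j) = {D - j..j}" .
  moreover have "inj_on (d a) (spine \<inter> level j)"
    using spine_bij by (auto simp: bij_betw_def intro: inj_on_subset)
  ultimately have "card (spine \<inter> level j) = card {D - j..j}" by (metis card_image)
  then show ?thesis using assms by simp
qed

lemma spine_inner: "spine - {a, b} \<subseteq> inner"
proof
  fix v assume v: "v \<in> spine - {a, b}"
  obtain u where u: "(v, u) \<in> E" "d a u = Suc (d a v)" using spine_next v by blast
  obtain w where w: "(v, w) \<in> E" "d a v = Suc (d a w)" using spine_prev v by blast
  have "card {u, w} \<le> deg v" unfolding deg_def using u w finite_nbrs by (intro card_mono) auto
  moreover have "u \<noteq> w" using u w by auto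
  ultimately show "v \<in> inner" using v by (auto simp: inner_def spine_def)
qed

lemma finite_spine: "finite spine" using spine_sub finite_V finite_subset by blast

lemma card_spine_interior: "1 \<le> D \<Longrightarrow> card (spine - {a, b}) = D - 1"
proof -
  assume D: "1 \<le> D"
  have "card spine = Suc D" using bij_betw_same_card[OF spine_bij] by simp
  moreover have "a \<noteq> b" using D d_self aV by force
  ultimately show ?thesis using ends_spine finite_spine by (simp add: card_Diff_subset)
qed

lemma finite_inner: "finite inner" using finite_V by (simp add: inner_def)

lemma diameter_le: "D \<le> Suc (card inner)"
  using card_spine_interior card_mono[OF finite_inner spine_inner] by (cases "1 \<le> D") auto

text \<open>The summand \<open>2 * j + 1 - D\<close> counts the spine vertices in
  \<open>level j\<close>. The rest bounds from below the number of branching vertices in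
  \<open>level (j - 1)\<close>, each of which supplies its own vertex of \<open>level j\<close> off
  the spine.\<close>

lemma level_lower:
  assumes "1 \<le> j" "j \<le> D"
  shows "card (level j) \<ge> 2 * j + 1 - D + (card branching + (2 * j - 1 - D) - card inner)"
proof -
  let ?B = "branching \<inter> level (j - 1)"
  let ?X = "spine \<inter> level (j - 1)"
  have finB: "finite branching" using finite_V by (simp add: branching_def)
  have "ec a = D" "ec b = D"
    using ec_eq aV bV d_self d_sym[OF aV bV] by auto
  then have "?X \<subseteq> spine - {a, b}" using assms by (auto simp: level_def)
  then have X: "?X \<subseteq> inner" using spine_inner by blast
  \<comment> \<open>A branching vertex outside \<open>level (j - 1)\<close> is an inner vertex
    outside that level, hence not in \<open>?X\<close>.\<close>
  have "card (branching - ?B) \<le> card (inner - ?X)"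
    using finite_inner by (intro card_mono) (auto simp: branching_def inner_def)
  moreover have "card (inner - ?X) = card inner - card ?X" "card ?X \<le> card inner"
    using X finite_inner finite_spine by (auto simp: card_Diff_subset card_mono)
  moreover have "card (branching - ?B) = card branching - card ?B"
    using finB by (simp add: card_Diff_subset_Int Int_absorb)
  moreover have "card ?X = 2 * j - 1 - D"
    using card_spine_level[of "j - 1"] assms by (simp add: diff_mult_distrib2 numeral_2_eq_2)
  ultimately have B: "card branching + (2 * j - 1 - D) - card inner \<le> card ?B" by linarith
  \<comment> \<open>In the tree rooted at \<open>a\<close> a branching vertex has at least two
    children. They are equally far from \<open>a\<close>, so at most one of them is on the
    spine.\<close>
  have "\<exists>w. w \<in> children a v - spine" if v: "v \<in> ?B" for v
  proof -
    have "v \<in> V" "3 \<le> deg v" using v by (auto simp: branching_def)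
    then have "2 \<le> card (children a v)" using deg_children[OF aV, of v] by (auto split: if_splits)
    moreover have "card (children a v \<inter> spine) \<le> 1"
    proof -
      have "card (children a v \<inter> spine) = card (d a ` (children a v \<inter> spine))"
        using spine_bij by (intro card_image[symmetric]) (auto simp: bij_betw_def intro: inj_on_subset)
      also have "\<dots> \<le> card {Suc (d a v)}" by (intro card_mono) (auto simp: children_def)
      finally show ?thesis by simp
    qed
    ultimately have "\<not> children a v \<subseteq> spine" by (metis Int_absorb2 Suc_1 not_less_eq_eq order_trans)
    then show ?thesis by blast
  qed
  then obtain g where g: "\<And>v. v \<in> ?B \<Longrightarrow> g v \<in> children a v - spine" by metis
  have "inj_on g ?B"
    using g children_disjoint[OF aV] unfolding inj_on_def by (metis DiffD1)
  moreover have "g ` ?B \<subseteq> level j - spine"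
  proof
    fix w assume "w \<in> g ` ?B"
    then obtain v where v: "v \<in> ?B" "w = g v" by blast
    then have "(v, w) \<in> E" "w \<notin> spine" using g unfolding children_def by auto
    moreover have "ec v \<le> j - 1" using v by (auto simp: level_def)
    ultimately show "w \<in> level j - spine"
      using ec_edge[of v w] arcs[of v w] assms by (auto simp: level_def)
  qed
  moreover have fl: "finite (level j)" using finite_V by (simp add: level_def)
  ultimately have "card ?B \<le> card (level j - spine)"
    by (metis card_image card_mono finite_Diff)
  moreover have "card (level j) = card (level j - spine) + card (spine \<inter> level j)"
    using fl by (metis Int_commute add.commute card_Diff_subset_Int card_mono finite_Int inf_le1 le_add_diff_inverse2)
  ultimately show ?thesis using B card_spine_level[OF assms(2)] by simp
qed

lemma level_full: "D \<le> j \<Longrightarrow> level j = V"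
  using ec_leI[of _ D] diametral unfolding level_def by fastforce

end

section \<open>Caterpillars\<close>

abbreviation caterpillar :: "nat \<Rightarrow> (nat \<Rightarrow> nat) \<Rightarrow> (nat \<times> nat) pair_pre_digraph" where
  "caterpillar k \<phi> \<equiv> attach_pendants (path_graph k) (num_pendants k \<phi>)"

text \<open>In a caterpillar whose inner vertices form the path \<open>1, \<dots>, k\<close>, both ends carry a pendant vertex,
  so the eccentricity of an inner vertex exceeds its eccentricity in the path by one.\<close>

definition spine_ecc :: "nat \<Rightarrow> nat \<Rightarrow> nat" where
  "spine_ecc k i = max i (k + 1 - i)"

lemma path_ecc:
  assumes "i \<in> {1..k}"
  shows "ecc (path_graph k) i = spine_ecc k i - 1"
proof -
  have wf: "pair_wf_digraph (path_graph k)"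
    by unfold_locales (auto simp: path_graph_def)
  have dist: "gdist (path_graph k) i y = (i - y) + (y - i)" if "y \<in> {1..k}" for y
  proof (rule gdist_eqI[OF wf])
    fix z assume "z \<in> pverts (path_graph k)" "z \<noteq> y"
    then show "\<exists>u. (z, u) \<in> parcs (path_graph k) \<and> z - y + (y - z) = Suc (u - y + (y - u))"
      using that by (intro exI[of _ "if z < y then Suc z else z - 1"]) (auto simp: path_graph_def)
  qed (use assms in \<open>auto simp: path_graph_def\<close>)
  have "ecc (path_graph k) i = Max ((\<lambda>y. (i - y) + (y - i)) ` {1..k})"
    unfolding ecc_def using dist
    by (intro arg_cong[where f = Max] image_cong) (simp_all add: path_graph_def[of k, THEN arg_cong[where f = pverts]])
  also have "\<dots> = spine_ecc k i - 1"
  proof (rule Max_eqI)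
    show "spine_ecc k i - 1 \<in> (\<lambda>y. (i - y) + (y - i)) ` {1..k}"
      using assms
      by (intro image_eqI[of _ _ "if k + 1 - i \<le> i then 1 else k"]) (auto simp: spine_ecc_def)
  qed (use assms in \<open>auto simp: spine_ecc_def\<close>)
  finally show ?thesis .
qed

locale caterpillar_graph =
  fixes k :: nat and \<phi> :: "nat \<Rightarrow> nat"
  assumes k_pos: "1 \<le> k" and phi_ge: "i \<in> {1..k} \<Longrightarrow> 2 \<le> \<phi> i"
begin

abbreviation m :: "nat \<Rightarrow> nat" where "m \<equiv> num_pendants k \<phi>"

abbreviation C :: "(nat \<times> nat) pair_pre_digraph" where "C \<equiv> caterpillar k \<phi>"

text \<open>The indicators count the spine neighbours of \<open>i\<close>, so the formula is uniform
  and includes \<open>k = 1\<close>. By \<open>phi_ge\<close> the truncated subtractions in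
  \<open>num_pendants\<close> are exact.\<close>

lemma phi_eq: "i \<in> {1..k} \<Longrightarrow> \<phi> i = m i + (if 1 < i then 1 else 0) + (if i < k then 1 else 0)"
  using phi_ge[of i] by (auto simp: num_pendants_def)

lemma verts_Sigma: "pverts C = Sigma {1..k} (\<lambda>i. {..m i})"
  by (auto simp: attach_pendants_def path_graph_def)

lemma arc_iff: "((i, j), (i', j')) \<in> parcs C \<longleftrightarrow>
   i \<in> {1..k} \<and> i' \<in> {1..k} \<and>
   (j = 0 \<and> j' = 0 \<and> (i' = Suc i \<or> i = Suc i') \<or>
    i = i' \<and> j = 0 \<and> 1 \<le> j' \<and> j' \<le> m i \<or> i = i' \<and> j' = 0 \<and> 1 \<le> j \<and> j \<le> m i)"
  by (auto simp: attach_pendants_def path_graph_def)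

lemma wf: "pair_wf_digraph C"
  by unfold_locales (auto simp: verts_Sigma arc_iff)

lemma finite_verts: "finite (pverts C)"
  by (simp add: verts_Sigma)

text \<open>Each pendant end adds one step to the distance along the spine. The diagonal is separate
  because this count would give 2 for a pendant vertex and itself.\<close>

lemma distance:
  assumes "(i, j) \<in> pverts C" "(i', j') \<in> pverts C"
  shows "gdist C (i, j) (i', j') =
    (if (i, j) = (i', j') then 0
     else (i - i') + (i' - i) + (if 0 < j then 1 else 0) + (if 0 < j' then 1 else 0))"
proof -
  define h where "h = (\<lambda>(i, j). if (i, j) = (i', j') then 0
     else (i - i') + (i' - i) + (if 0 < j then 1 else 0) + (if 0 < j' then 1 else 0) :: nat)"
  have "gdist C (i, j) (i', j') = h (i, j)"
  proof (rule gdist_eqI[OF wf assms(1)])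
    fix z assume "z \<in> pverts C"
    then show "h z = 0 \<longleftrightarrow> z = (i', j')" by (cases z) (auto simp: h_def)
  next
    fix u v assume "(u, v) \<in> parcs C"
    then show "h u \<le> Suc (h v)" by (cases u; cases v) (auto simp: h_def arc_iff split: if_splits)
  next
    fix z assume z: "z \<in> pverts C" "z \<noteq> (i', j')"
    obtain p q where pq: "z = (p, q)" by (cases z)
    \<comment> \<open>The next vertex on the way to \<open>(i', j')\<close>: first leave a pendant
      vertex, then move along the spine, finally enter the target.\<close>
    define u where "u = (if 0 < q then (p, 0) else if p < i' then (Suc p, 0)
      else if i' < p then (p - 1, 0) else (i', j'))"
    have range: "1 \<le> p" "p \<le> k" "q \<le> m p" "1 \<le> i'" "i' \<le> k" "j' \<le> m i'"
      using z assms(2) by (auto simp: pq verts_Sigma)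
    consider "0 < q" | "q = 0" "p < i'" | "q = 0" "i' < p" | "q = 0" "p = i'" "0 < j'"
      using z(2) pq by fastforce
    then have "(z, u) \<in> parcs C \<and> h z = Suc (h u)"
    proof cases
      case 1
      then show ?thesis using z(2) range by (simp add: pq u_def arc_iff h_def)
    next
      case 2
      then show ?thesis using range by (auto simp: pq u_def arc_iff h_def)
    next
      case 3
      then show ?thesis using range by (auto simp: pq u_def arc_iff h_def)
    next
      case 4
      then show ?thesis using range by (simp add: pq u_def arc_iff h_def)
    qed
    then show "\<exists>u. (z, u) \<in> parcs C \<and> h z = Suc (h u)" by blast
  qed
  then show ?thesis by (simp add: h_def)
qed

lemma eccentricity:
  assumes v: "(i, j) \<in> pverts C"
  shows "ecc C (i, j) = spine_ecc k i + (if 0 < j then 1 else 0)"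
  unfolding ecc_def
proof (rule Max_eqI)
  show "finite (gdist C (i, j) ` pverts C)" using finite_verts by simp
next
  fix y assume "y \<in> gdist C (i, j) ` pverts C"
  then obtain i' j' where "(i', j') \<in> pverts C" "y = gdist C (i, j) (i', j')" by auto
  then show "y \<le> spine_ecc k i + (if 0 < j then 1 else 0)"
    using v by (auto simp: distance verts_Sigma spine_ecc_def)
next
  have i: "i \<in> {1..k}" using v by (simp add: verts_Sigma)
  have m1: "1 \<le> m 1" "1 \<le> m k" using phi_ge[of 1] phi_ge[of k] k_pos by (auto simp: num_pendants_def)
  have "\<exists>w\<in>pverts C. gdist C (i, j) w = spine_ecc k i + (if 0 < j then 1 else 0)"
  proof (cases "k = 1")
    case True
    \<comment> \<open>In a star the farthest vertex is a leaf different from \<open>(i, j)\<close>;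
      the bound \<open>2 \<le> m 1\<close> provides a second leaf.\<close>
    define j' where "j' = (if j = 1 then 2 else 1 :: nat)"
    have "2 \<le> m 1" using phi_ge[of 1] True by (simp add: num_pendants_def)
    then have "(1, j') \<in> pverts C" using k_pos unfolding verts_Sigma j'_def by auto
    then show ?thesis using i True v distance[OF v, of 1 j']
      by (intro bexI[of _ "(1, j')"]) (auto simp: spine_ecc_def j'_def)
  next
    case False
    define i' where "i' = (if k + 1 - i \<le> i then 1 else k)"
    have "(i', 1) \<in> pverts C" using m1 k_pos by (auto simp: verts_Sigma i'_def)
    moreover have "i' \<noteq> i" using False i by (auto simp: i'_def)
    ultimately show ?thesis using i v distance[OF v, of i' 1]
      by (intro bexI[of _ "(i', 1)"]) (auto simp: spine_ecc_def i'_def)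
  qed
  then show "spine_ecc k i + (if 0 < j then 1 else 0) \<in> gdist C (i, j) ` pverts C"
    by force
qed

lemma degree_spine:
  assumes "i \<in> {1..k}"
  shows "gdegree C (i, 0) = \<phi> i"
proof -
  have "{y. ((i, 0), y) \<in> parcs C} = Pair i ` {1..m i} \<union>
     ((if 1 < i then {(i - 1, 0)} else {}) \<union> (if i < k then {(Suc i, 0)} else {}))"
    using assms by (auto simp: arc_iff split: if_splits)
  also have "card \<dots> = m i + card ((if 1 < i then {(i - 1, 0)} else {}) \<union>
     (if i < k then {(Suc i, 0)} else {}) :: (nat \<times> nat) set)"
    by (subst card_Un_disjoint) (auto simp: card_image inj_on_def split: if_splits)
  also have "\<dots> = \<phi> i" using phi_eq[OF assms] by auto
  finally show ?thesis by (simp add: gdegree_card)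
qed

lemma degree_pendant:
  assumes "(i, j) \<in> pverts C" "0 < j"
  shows "gdegree C (i, j) = 1"
proof -
  have "{y. ((i, j), y) \<in> parcs C} = {(i, 0)}"
    using assms by (auto simp: arc_iff verts_Sigma)
  then show ?thesis by (simp add: gdegree_card)
qed

text \<open>Degree and eccentricity are known separately on spine and pendant vertices; suitable
  choices of \<open>w\<close> then give level sizes and level degrees.\<close>

lemma sum_verts:
  "(\<Sum>v\<in>pverts C. w (gdegree C v) (ecc C v)) =
   (\<Sum>i=1..k. w (\<phi> i) (spine_ecc k i)) + (\<Sum>i=1..k. of_nat (m i) * (w 1 (Suc (spine_ecc k i)) :: 'b :: semiring_1))"
proof -
  have "(\<Sum>v\<in>pverts C. w (gdegree C v) (ecc C v)) =
    (\<Sum>i=1..k. \<Sum>j\<le>m i. w (gdegree C (i, j)) (ecc C (i, j)))"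
    unfolding verts_Sigma by (subst sum.Sigma) (auto simp: case_prod_beta)
  also have "\<dots> = (\<Sum>i=1..k. w (\<phi> i) (spine_ecc k i) + of_nat (m i) * w 1 (Suc (spine_ecc k i)))"
  proof (rule sum.cong[OF refl])
    fix i assume i: "i \<in> {1..k}"
    have "w (gdegree C (i, j)) (ecc C (i, j)) = (if j = 0 then w (\<phi> i) (spine_ecc k i) else w 1 (Suc (spine_ecc k i)))"
      if "j \<le> m i" for j
    proof -
      have "(i, j) \<in> pverts C" using i that by (simp add: verts_Sigma)
      then show ?thesis using eccentricity degree_spine[OF i] degree_pendant by auto
    qed
    then have "(\<Sum>j\<le>m i. w (gdegree C (i, j)) (ecc C (i, j))) =
      (\<Sum>j\<le>m i. if j = 0 then w (\<phi> i) (spine_ecc k i) else w 1 (Suc (spine_ecc k i)))"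
      by (intro sum.cong) auto
    also have "\<dots> = w (\<phi> i) (spine_ecc k i) + of_nat (m i) * w 1 (Suc (spine_ecc k i))"
      by (subst sum.atMost_shift) simp
    finally show "(\<Sum>j\<le>m i. w (gdegree C (i, j)) (ecc C (i, j))) = \<dots>" .
  qed
  finally show ?thesis by (simp add: sum.distrib)
qed

end

section \<open>Summation by parts for \<open>xi_ce\<close>\<close>

definition ecc_level :: "'a pair_pre_digraph \<Rightarrow> nat \<Rightarrow> 'a set" where
  "ecc_level G j = {v \<in> pverts G. ecc G v \<le> j}"

definition level_degree :: "'a pair_pre_digraph \<Rightarrow> nat \<Rightarrow> nat" where
  "level_degree G j = (\<Sum>v\<in>ecc_level G j. gdegree G v)"

lemma card_ecc_level_sum:
  "finite (pverts G) \<Longrightarrow> card (ecc_level G j) = (\<Sum>v\<in>pverts G. if ecc G v \<le> j then 1 else 0)"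
  by (simp only: ecc_level_def card_eq_sum sum.inter_filter)

lemma level_degree_sum:
  "finite (pverts G) \<Longrightarrow> level_degree G j = (\<Sum>v\<in>pverts G. if ecc G v \<le> j then gdegree G v else 0)"
  by (simp add: level_degree_def ecc_level_def sum.inter_filter)

text \<open>By telescoping, \<open>1 / real e\<close> is the sum of
  \<open>1 / real j - 1 / real (Suc j)\<close> over \<open>e \<le> j < N\<close> plus
  \<open>1 / real N\<close>; exchanging the sums collects the degrees of each level. Any upper bound
  \<open>N\<close> is allowed, so two graphs can be expanded with the same coefficients.\<close>

lemma xi_ce_levels:
  assumes fin: "finite (pverts G)"
    and bounds: "\<And>v. v \<in> pverts G \<Longrightarrow> 1 \<le> ecc G v \<and> ecc G v \<le> N"
  shows "xi_ce G = (\<Sum>j=1..<N. (1 / real j - 1 / real (Suc j)) * real (level_degree G j)) +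
    real (level_degree G N) / real N"
proof -
  let ?w = "\<lambda>j. 1 / real j - 1 / real (Suc j)"
  have inv: "1 / real e = (\<Sum>j=1..<N. if e \<le> j then ?w j else 0) + 1 / real N" if "1 \<le> e" "e \<le> N" for e
  proof -
    have "(\<Sum>j=1..<N. if e \<le> j then ?w j else 0) = (\<Sum>j=e..<N. ?w j)"
      using that by (intro sum.mono_neutral_cong_right) auto
    also have "\<dots> = 1 / real e - 1 / real N"
      using sum_Suc_diff'[OF that(2), of "\<lambda>j. - 1 / real j"] by simp
    finally show ?thesis by simp
  qed
  have "xi_ce G = (\<Sum>v\<in>pverts G. real (gdegree G v) *
      ((\<Sum>j=1..<N. if ecc G v \<le> j then ?w j else 0) + 1 / real N))"
    unfolding xi_ce_def
  proof (rule sum.cong[OF refl])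
    fix v assume "v \<in> pverts G"
    then have "1 / real (ecc G v) = (\<Sum>j=1..<N. if ecc G v \<le> j then ?w j else 0) + 1 / real N"
      using bounds by (intro inv) auto
    then show "real (gdegree G v) / real (ecc G v) = real (gdegree G v) *
        ((\<Sum>j=1..<N. if ecc G v \<le> j then ?w j else 0) + 1 / real N)"
      unfolding divide_inverse[of "real (gdegree G v)" "real (ecc G v)"] inverse_eq_divide
      by (simp only:)
  qed
  also have "\<dots> = (\<Sum>v\<in>pverts G. \<Sum>j=1..<N. if ecc G v \<le> j then ?w j * real (gdegree G v) else 0) +
      (\<Sum>v\<in>pverts G. real (gdegree G v)) / real N"
  proof -
    have "real (gdegree G v) * ((\<Sum>j=1..<N. if ecc G v \<le> j then ?w j else 0) + 1 / real N) =
        (\<Sum>j=1..<N. if ecc G v \<le> j then ?w j * real (gdegree G v) else 0) + real (gdegree G v) / real N" for v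
      unfolding distrib_left sum_distrib_left
      by (intro arg_cong2[where f = "(+)"] sum.cong) auto
    then show ?thesis by (simp only: sum.distrib sum_divide_distrib)
  qed
  also have "(\<Sum>v\<in>pverts G. \<Sum>j=1..<N. if ecc G v \<le> j then ?w j * real (gdegree G v) else 0) =
     (\<Sum>j=1..<N. ?w j * real (level_degree G j))"
    by (subst sum.swap) (simp add: level_degree_sum[OF fin] sum_distrib_left if_distrib cong: if_cong)
  also have "(\<Sum>v\<in>pverts G. real (gdegree G v)) = real (level_degree G N)"
    using bounds by (simp add: level_degree_sum[OF fin])
  finally show ?thesis .
qed

text \<open>Both expansions have the same positive coefficients, so the comparison is termwise, and
  equality of the sums forces equality at every index below \<open>N\<close>.\<close>

lemma xi_ce_compare:
  assumes fin: "finite (pverts G)" "finite (pverts H)"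
    and bG: "\<And>v. v \<in> pverts G \<Longrightarrow> 1 \<le> ecc G v \<and> ecc G v \<le> N"
    and bH: "\<And>v. v \<in> pverts H \<Longrightarrow> 1 \<le> ecc H v \<and> ecc H v \<le> N"
    and le: "\<And>j. 1 \<le> j \<Longrightarrow> level_degree H j \<le> level_degree G j"
  shows "xi_ce H \<le> xi_ce G"
    and "xi_ce H = xi_ce G \<Longrightarrow> 1 \<le> j \<Longrightarrow> j < N \<Longrightarrow> level_degree H j = level_degree G j"
proof -
  let ?w = "\<lambda>j. 1 / real j - 1 / real (Suc j)"
  have wpos: "0 < ?w j" if "1 \<le> j" for j
    using that by (simp add: frac_less2)
  \<comment> \<open>For \<open>N = 0\<close> both quotients are 0, since \<open>le\<close> speaks of
    positive indices only.\<close>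
  have last: "real (level_degree H N) / real N \<le> real (level_degree G N) / real N"
    using le[of N] by (cases "N = 0") (auto intro: divide_right_mono)
  have terms: "?w j * real (level_degree H j) \<le> ?w j * real (level_degree G j)" if "1 \<le> j" for j
    using le[OF that] wpos[OF that] by (intro mult_left_mono) auto
  then have sums: "(\<Sum>j=1..<N. ?w j * real (level_degree H j)) \<le> (\<Sum>j=1..<N. ?w j * real (level_degree G j))"
    by (intro sum_mono) auto
  show "xi_ce H \<le> xi_ce G"
    using sums last xi_ce_levels[OF fin(1) bG] xi_ce_levels[OF fin(2) bH] by linarith
  assume eq: "xi_ce H = xi_ce G" and j: "1 \<le> j" "j < N"
  show "level_degree H j = level_degree G j"
  proof (rule ccontr)
    assume "level_degree H j \<noteq> level_degree G j"
    then have "?w j * real (level_degree H j) < ?w j * real (level_degree G j)"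
      using le[OF j(1)] wpos[OF j(1)] by (intro mult_strict_left_mono) auto
    then have "(\<Sum>j=1..<N. ?w j * real (level_degree H j)) < (\<Sum>j=1..<N. ?w j * real (level_degree G j))"
      using terms j by (intro sum_strict_mono_ex1) auto
    then show False
      using eq last xi_ce_levels[OF fin(1) bG] xi_ce_levels[OF fin(2) bH] by linarith
  qed
qed

lemma giso_card_ecc_level:
  assumes "pair_wf_digraph G" "pair_wf_digraph H" "giso G H" "finite (pverts G)" "finite (pverts H)"
  shows "card (ecc_level G j) = card (ecc_level H j)"
  using sum_with_ecc_giso[OF assms(1-3), of "\<lambda>_ e. if e \<le> j then 1 else 0 :: nat"] assms(4,5)
  by (simp add: card_ecc_level_sum)

section \<open>Level sizes and level degrees of a caterpillar\<close>

definition spine_count :: "nat \<Rightarrow> nat \<Rightarrow> nat" where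
  "spine_count k j = card {i \<in> {1..k}. spine_ecc k i \<le> j}"

lemma spine_count_eq:
  assumes "j \<le> k"
  shows "spine_count k j = 2 * j - k"
proof -
  have "{i \<in> {1..k}. spine_ecc k i \<le> j} = {k + 1 - j..j}"
    using assms by (auto simp: spine_ecc_def)
  then show ?thesis using assms by (simp add: spine_count_def)
qed

lemma spine_count_full:
  assumes "k \<le> j"
  shows "spine_count k j = k"
proof -
  have "{i \<in> {1..k}. spine_ecc k i \<le> j} = {1..k}"
    using assms by (auto simp: spine_ecc_def)
  then show ?thesis by (simp add: spine_count_def)
qed

context caterpillar_graph
begin

text \<open>The inequality is strict because a pendant vertex has eccentricity one larger than its
  spine vertex: these are the pendant vertices of eccentricity at most \<open>j\<close>.\<close>

definition pendants_below :: "nat \<Rightarrow> nat" where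
  "pendants_below j = (\<Sum>i\<in>{i \<in> {1..k}. spine_ecc k i < j}. m i)"

lemma card_level: "card (ecc_level C j) = spine_count k j + pendants_below j"
  using sum_verts[of "\<lambda>_ e. if e \<le> j then 1 else 0 :: nat"] finite_verts
  by (simp add: card_ecc_level_sum spine_count_def pendants_below_def sum.inter_filter if_distrib
      Suc_le_eq cong: if_cong flip: sum.inter_filter)

lemma level_degree_eq:
  "level_degree C j = (\<Sum>i\<in>{i \<in> {1..k}. spine_ecc k i \<le> j}. \<phi> i) + pendants_below j"
  using sum_verts[of "\<lambda>d e. if e \<le> j then d else 0 :: nat"] finite_verts
  by (simp add: level_degree_sum pendants_below_def sum.inter_filter if_distrib
      Suc_le_eq cong: if_cong flip: sum.inter_filter)

lemma sum_ends: "(\<Sum>i=1..k. (if 1 < i then 1 else 0) + (if i < k then 1 else 0)) + 2 = 2 * k"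
proof -
  have "(\<Sum>i=1..k. if 1 < i then 1 else 0 :: nat) = (\<Sum>i\<in>{2..k}. 1)"
    by (intro sum.mono_neutral_cong_right) auto
  moreover have "(\<Sum>i=1..k. if i < k then 1 else 0 :: nat) = (\<Sum>i\<in>{1..<k}. 1)"
    by (intro sum.mono_neutral_cong_right) auto
  ultimately show ?thesis using k_pos by (simp add: sum.distrib)
qed

lemma card_verts: "card (pverts C) + k = (\<Sum>i=1..k. \<phi> i) + 2"
proof -
  have "card (pverts C) = k + (\<Sum>i=1..k. m i)"
    by (simp add: verts_Sigma sum_Suc)
  moreover have "(\<Sum>i=1..k. \<phi> i) =
      (\<Sum>i=1..k. m i + ((if 1 < i then 1 else 0) + (if i < k then 1 else 0)))"
    using phi_eq by (intro sum.cong) (auto simp: add.assoc)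
  then have "(\<Sum>i=1..k. \<phi> i) =
      (\<Sum>i=1..k. m i) + (\<Sum>i=1..k. (if 1 < i then 1 else 0) + (if i < k then 1 else 0))"
    by (simp only: sum.distrib)
  ultimately show ?thesis using sum_ends by linarith
qed

lemma spine_count_0:
  assumes "spine_count k j = 0"
  shows "pendants_below j = 0" and "level_degree C j = 0"
proof -
  have empty: "{i \<in> {1..k}. spine_ecc k i \<le> j} = {}" using assms by (simp add: spine_count_def)
  then have "{i \<in> {1..k}. spine_ecc k i < j} = {}" by fastforce
  then show "pendants_below j = 0" by (simp only: pendants_below_def sum.empty)
  then show "level_degree C j = 0" by (simp only: level_degree_eq empty sum.empty)
qed

lemma ecc_bounds:
  assumes "v \<in> pverts C"
  shows "1 \<le> ecc C v" "ecc C v \<le> Suc k"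
proof -
  obtain i j where v: "v = (i, j)" by (cases v)
  then have "i \<in> {1..k}" using assms by (simp add: verts_Sigma)
  then show "1 \<le> ecc C v" "ecc C v \<le> Suc k"
    using eccentricity[of i j] assms v by (auto simp: spine_ecc_def)
qed

text \<open>Reverse of the estimate in \<open>level_deg_sum\<close>. All pendant vertices at spine
  vertices of \<open>ecc_level C j\<close> belong to the next level, so they cancel, and only the
  degrees \<open>?g\<close> within the spine are compared with the spine counts.\<close>

lemma level_degree_le:
  assumes "1 \<le> spine_count k j"
  shows "level_degree C j + 2 \<le> card (ecc_level C j) + card (ecc_level C (Suc j))"
proof -
  let ?I = "{i \<in> {1..k}. spine_ecc k i \<le> j}"
  let ?g = "\<lambda>i. (if 1 < i then 1 else 0) + (if i < k then 1 else 0) :: nat"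
  have "(\<Sum>i\<in>?I. \<phi> i) = (\<Sum>i\<in>?I. m i + ?g i)"
    using phi_eq by (intro sum.cong) (auto simp: add.assoc)
  moreover have "?I = {i \<in> {1..k}. spine_ecc k i < Suc j}" by auto
  ultimately have phi: "(\<Sum>i\<in>?I. \<phi> i) = pendants_below (Suc j) + (\<Sum>i\<in>?I. ?g i)"
    by (simp add: sum.distrib pendants_below_def)
  have "(\<Sum>i\<in>?I. ?g i) + 2 \<le> spine_count k j + spine_count k (Suc j)"
  proof (cases "j < k")
    case True
    have "(\<Sum>i\<in>?I. ?g i) \<le> (\<Sum>i\<in>?I. 2)" by (intro sum_mono) auto
    also have "\<dots> = 2 * spine_count k j" by (simp add: spine_count_def)
    finally show ?thesis using True assms spine_count_eq[of j k] spine_count_eq[of "Suc j" k] by simp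
  next
    case False
    then have "?I = {1..k}" by (auto simp: spine_ecc_def)
    then show ?thesis
      using spine_count_full[of k j] spine_count_full[of k "Suc j"] sum_ends False by simp
  qed
  then show ?thesis
    unfolding level_degree_eq phi card_level by simp
qed

end

text \<open>The pendant vertices counted sit at entries 3 of eccentricity below \<open>j\<close>. If
  there is one, the greedy condition puts a 3 at all \<open>k - (2 * j - 2 - k)\<close> spine
  vertices of eccentricity at least \<open>j\<close>, and only the rest of the \<open>r\<close>
  threes remains.\<close>

lemma pendants_below_greedy:
  assumes "caterpillar_graph k \<phi>"
    and phi: "\<And>i. i \<in> {1..k} \<Longrightarrow> \<phi> i \<in> {2, 3}"
    and three: "card {i \<in> {1..k}. \<phi> i = 3} = r"
    and greedy: "\<And>i i'. i \<in> {1..k} \<Longrightarrow> i' \<in> {1..k} \<Longrightarrow> spine_ecc k i' < spine_ecc k i \<Longrightarrow> \<phi> i' \<le> \<phi> i"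
    and j: "1 \<le> j" "j \<le> k"
  shows "caterpillar_graph.pendants_below k \<phi> j \<le> r + (2 * j - 2 - k) - k"
proof -
  interpret caterpillar_graph k \<phi> by fact
  let ?L = "{i \<in> {1..k}. spine_ecc k i < j}"
  let ?H = "{i \<in> {1..k}. j \<le> spine_ecc k i}"
  \<comment> \<open>Since \<open>j \<le> k\<close>, no end of the spine has eccentricity below
    \<open>j\<close>, so the number of pendants is \<open>\<phi> i - 2\<close>.\<close>
  have "m i = (if \<phi> i = 3 then 1 else 0)" if "i \<in> ?L" for i
    using that phi[of i] j by (auto simp: num_pendants_def spine_ecc_def)
  then have "pendants_below j = (\<Sum>i\<in>?L. if \<phi> i = 3 then 1 else 0)"
    unfolding pendants_below_def by (intro sum.cong) auto
  also have "\<dots> = card {i \<in> ?L. \<phi> i = 3}"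
    by (simp add: sum.If_cases Int_def)
  finally have pb: "pendants_below j = card {i \<in> ?L. \<phi> i = 3}" .
  show ?thesis
  proof (cases "{i \<in> ?L. \<phi> i = 3} = {}")
    case False
    then obtain i0 where i0: "i0 \<in> ?L" "\<phi> i0 = 3" by blast
    have "\<phi> i = 3" if "i \<in> ?H" for i
      using greedy[of i i0] i0 that phi[of i] by auto
    then have "{i \<in> ?L. \<phi> i = 3} \<union> ?H \<subseteq> {i \<in> {1..k}. \<phi> i = 3}" by auto
    then have "card ({i \<in> ?L. \<phi> i = 3} \<union> ?H) \<le> r"
      using card_mono[of "{i \<in> {1..k}. \<phi> i = 3}"] three by simp
    moreover have "card ({i \<in> ?L. \<phi> i = 3} \<union> ?H) = pendants_below j + card ?H"
      unfolding pb by (intro card_Un_disjoint) auto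
    moreover have "card ?H + spine_count k (j - 1) = k"
    proof -
      have "{1..k} = ?H \<union> {i \<in> {1..k}. spine_ecc k i \<le> j - 1}" using j by auto
      moreover have "?H \<inter> {i \<in> {1..k}. spine_ecc k i \<le> j - 1} = {}" using j by auto
      ultimately show ?thesis unfolding spine_count_def
        by (metis (no_types, lifting) card_Un_disjoint card_atLeastAtMost diff_Suc_1 finite_Un finite_atLeastAtMost)
    qed
    ultimately show ?thesis
      using spine_count_eq[of "j - 1" k] j by (simp add: diff_mult_distrib2)
  next
    case True
    show ?thesis unfolding pb True by simp
  qed
qed

section \<open>Caterpillars determined up to reversal\<close>

lemma caterpillar_cong:
  assumes "\<And>i. i \<in> {1..k} \<Longrightarrow> \<phi> i = \<psi> i"
  shows "caterpillar k \<phi> = caterpillar k \<psi>"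
proof -
  have "num_pendants k \<phi> i = num_pendants k \<psi> i" if "i \<in> {1..k}" for i
    using assms[OF that] by (simp add: num_pendants_def)
  then show ?thesis unfolding attach_pendants_def path_graph_def by auto
qed

text \<open>The reflection of the spine keeps the pendant labels and is its own inverse.\<close>

lemma giso_caterpillar_rev:
  assumes "caterpillar_graph k \<phi>" "caterpillar_graph k \<psi>"
    and rev: "\<And>i. i \<in> {1..k} \<Longrightarrow> \<phi> i = \<psi> (k + 1 - i)"
  shows "giso (caterpillar k \<phi>) (caterpillar k \<psi>)"
proof -
  interpret A: caterpillar_graph k \<phi> by fact
  interpret B: caterpillar_graph k \<psi> by fact
  have m: "A.m i = B.m (k + 1 - i)" if "i \<in> {1..k}" for i
    using rev[OF that] that by (auto simp: num_pendants_def)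
  let ?f = "\<lambda>(i, j). (k + 1 - i, j)"
  have "bij_betw ?f (pverts A.C) (pverts B.C)"
  proof (rule bij_betw_byWitness[where f' = ?f])
    show "?f ` pverts A.C \<subseteq> pverts B.C" using m by (auto simp: A.verts_Sigma B.verts_Sigma)
    have "B.m i = A.m (k + 1 - i)" if "i \<in> {1..k}" for i using m[of "k + 1 - i"] that by fastforce
    then show "?f ` pverts B.C \<subseteq> pverts A.C" by (auto simp: A.verts_Sigma B.verts_Sigma)
  qed (auto simp: A.verts_Sigma B.verts_Sigma)
  moreover have "(u, v) \<in> parcs A.C \<longleftrightarrow> (?f u, ?f v) \<in> parcs B.C"
    if uv: "u \<in> pverts A.C" "v \<in> pverts A.C" for u v
  proof -
    obtain i j i' j' where [simp]: "u = (i, j)" "v = (i', j')" by (cases u; cases v)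
    have i: "1 \<le> i" "i \<le> k" "1 \<le> i'" "i' \<le> k" using uv by (auto simp: A.verts_Sigma)
    then have "B.m (k + 1 - i) = A.m i" using m[of i] by simp
    moreover have "k + 1 - i = k + 1 - i' \<longleftrightarrow> i = i'" "k + 1 - i' = Suc (k + 1 - i) \<longleftrightarrow> i = Suc i'"
      "k + 1 - i = Suc (k + 1 - i') \<longleftrightarrow> i' = Suc i" "k + 1 - i \<in> {1..k}" "k + 1 - i' \<in> {1..k}"
      using i by auto
    ultimately show ?thesis using i by (simp only: prod.case A.arc_iff B.arc_iff \<open>u = _\<close> \<open>v = _\<close>) auto
  qed
  ultimately show ?thesis unfolding giso_iff[OF A.wf B.wf] by blast
qed

text \<open>Opposite vertices have equal eccentricity. If \<open>\<psi>\<close> differs on one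
  opposite pair, the greedy condition forces 2 on all pairs of smaller eccentricity and 3 on all
  pairs of larger one. These are determined by their sums, and only the orientation of the one
  unbalanced pair is free.\<close>

lemma phi_unique_up_to_rev:
  assumes phi: "\<And>i. i \<in> {1..k} \<Longrightarrow> \<phi> i \<in> {2, 3}" and psi: "\<And>i. i \<in> {1..k} \<Longrightarrow> \<psi> i \<in> {2, 3 :: nat}"
    and greedy: "\<And>i i'. i \<in> {1..k} \<Longrightarrow> i' \<in> {1..k} \<Longrightarrow> spine_ecc k i' < spine_ecc k i \<Longrightarrow> \<psi> i' \<le> \<psi> i"
    and pairs: "\<And>i. i \<in> {1..k} \<Longrightarrow> \<phi> i + \<phi> (k + 1 - i) = \<psi> i + \<psi> (k + 1 - i)"
  shows "(\<forall>i\<in>{1..k}. \<phi> i = \<psi> i) \<or> (\<forall>i\<in>{1..k}. \<phi> i = \<psi> (k + 1 - i))"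
proof (cases "\<forall>i\<in>{1..k}. \<phi> i = \<psi> i")
  case False
  then obtain i0 where i0: "i0 \<in> {1..k}" "\<phi> i0 \<noteq> \<psi> i0" by blast
  have flip: "k + 1 - i \<in> {1..k}" "spine_ecc k (k + 1 - i) = spine_ecc k i" if "i \<in> {1..k}" for i
    using that by (auto simp: spine_ecc_def)
  \<comment> \<open>Two equal entries sum to 4 or 6, and neither splits into twos and threes in
    another way.\<close>
  have balanced: "\<phi> i = \<psi> i \<and> \<phi> i = \<psi> (k + 1 - i)" if "i \<in> {1..k}" "\<psi> i = \<psi> (k + 1 - i)" for i
    using pairs[OF that(1)] that phi[OF that(1)] psi[OF that(1)] phi[OF flip(1)[OF that(1)]] by auto
  have ne: "\<psi> i0 \<noteq> \<psi> (k + 1 - i0)" using balanced i0 by blast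
  have "\<phi> i = \<psi> (k + 1 - i)" if i: "i \<in> {1..k}" for i
  proof (cases "spine_ecc k i = spine_ecc k i0")
    case True
    then have "i = i0 \<or> i = k + 1 - i0" using i i0(1) by (auto simp: spine_ecc_def)
    then show ?thesis
      using pairs[OF i0(1)] i0 ne phi[OF i0(1)] psi[OF i0(1)] phi[OF flip(1)[OF i0(1)]] psi[OF flip(1)[OF i0(1)]]
      by auto
  next
    case False
    note f = flip[OF i] flip[OF i0(1)]
    have "\<psi> i = \<psi> (k + 1 - i)"
    proof (cases "spine_ecc k i < spine_ecc k i0")
      case True
      then have "\<psi> i \<le> \<psi> i0" "\<psi> i \<le> \<psi> (k + 1 - i0)" "\<psi> (k + 1 - i) \<le> \<psi> i0"
        "\<psi> (k + 1 - i) \<le> \<psi> (k + 1 - i0)"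
        using f i i0(1) by (intro greedy; simp)+
      then show ?thesis
        using ne psi[OF i] psi[OF f(1)] psi[OF i0(1)] psi[OF f(3)] by auto
    next
      case False
      then have "spine_ecc k i0 < spine_ecc k i" using \<open>spine_ecc k i \<noteq> spine_ecc k i0\<close> by simp
      then have "\<psi> i0 \<le> \<psi> i" "\<psi> (k + 1 - i0) \<le> \<psi> i" "\<psi> i0 \<le> \<psi> (k + 1 - i)"
        "\<psi> (k + 1 - i0) \<le> \<psi> (k + 1 - i)"
        using f i i0(1) by (intro greedy; simp)+
      then show ?thesis
        using ne psi[OF i] psi[OF f(1)] psi[OF i0(1)] psi[OF f(3)] by auto
    qed
    then show ?thesis using balanced i by blast
  qed
  then show ?thesis by blast
qed simp

text \<open>The increase of \<open>pendants_below\<close> from \<open>?e\<close> to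
  \<open>Suc ?e\<close> counts the pendant vertices at the pair \<open>i\<close>,
  \<open>k + 1 - i\<close>, and \<open>phi_eq\<close> turns these into entries.\<close>

lemma pendants_below_pairs:
  assumes "caterpillar_graph k \<phi>" "caterpillar_graph k \<psi>"
    and eq: "\<And>j. 1 \<le> j \<Longrightarrow> caterpillar_graph.pendants_below k \<phi> j = caterpillar_graph.pendants_below k \<psi> j"
    and i: "i \<in> {1..k}"
  shows "\<phi> i + \<phi> (k + 1 - i) = \<psi> i + \<psi> (k + 1 - i)"
proof -
  interpret A: caterpillar_graph k \<phi> by fact
  interpret B: caterpillar_graph k \<psi> by fact
  let ?e = "spine_ecc k i" and ?i' = "k + 1 - i"
  have i': "?i' \<in> {1..k}" using i by auto
  have split: "{x \<in> {1..k}. spine_ecc k x < Suc ?e} = {x \<in> {1..k}. spine_ecc k x < ?e} \<union> {i, ?i'}"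
    and disj: "{x \<in> {1..k}. spine_ecc k x < ?e} \<inter> {i, ?i'} = {}"
    using i by (auto simp: spine_ecc_def)
  have "(\<Sum>x\<in>{x \<in> {1..k}. spine_ecc k x < Suc ?e}. f x) =
      (\<Sum>x\<in>{x \<in> {1..k}. spine_ecc k x < ?e}. f x) + (\<Sum>x\<in>{i, ?i'}. f x)" for f :: "nat \<Rightarrow> nat"
    unfolding split using disj by (intro sum.union_disjoint) auto
  moreover have "1 \<le> ?e" using i by (auto simp: spine_ecc_def)
  ultimately have "(\<Sum>x\<in>{i, ?i'}. A.m x) = (\<Sum>x\<in>{i, ?i'}. B.m x)"
    using eq[of ?e] eq[of "Suc ?e"] unfolding A.pendants_below_def B.pendants_below_def by simp
  \<comment> \<open>For a middle vertex the set is a singleton, and its equation is doubled.\<close>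
  then have "A.m i + A.m ?i' = B.m i + B.m ?i'"
    by (cases "i = ?i'") auto
  then show ?thesis
    using A.phi_eq[OF i] B.phi_eq[OF i] A.phi_eq[OF i'] B.phi_eq[OF i'] by simp
qed

section \<open>Trees whose inner vertices lie on a diametral path\<close>

context diametral_tree
begin

text \<open>Two adjacent leaves would be cut off from an inner vertex \<open>z\<close>: each would
  have to be one step farther from \<open>z\<close> than the other.\<close>

lemma outer_neighbour:
  assumes "inner \<noteq> {}" and x: "x \<in> V" "x \<notin> inner"
  shows "\<exists>y. {u. (x, u) \<in> E} = {y} \<and> y \<in> inner"
proof -
  have leaf: "\<exists>y. {u. (v, u) \<in> E} = {y}" if v: "v \<in> V" "v \<notin> inner" for v
  proof -
    obtain z where "z \<in> inner" using assms(1) by blast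
    then have "z \<in> V" "z \<noteq> v" using v by (auto simp: inner_def)
    then obtain u where "(v, u) \<in> E" using d_step v by blast
    moreover have "card {u. (v, u) \<in> E} \<le> 1" using v by (simp add: inner_def deg_def)
    ultimately show ?thesis
      using finite_nbrs[of v] by (metis One_nat_def card_1_singletonE card_gt_0_iff empty_iff le_antisym less_eq_Suc_le mem_Collect_eq)
  qed
  obtain y where y: "{u. (x, u) \<in> E} = {y}" using leaf[OF x] by blast
  have xy: "(x, y) \<in> E" and yV: "y \<in> V" using y arcs by auto
  have "y \<in> inner"
  proof (rule ccontr)
    assume "y \<notin> inner"
    then obtain y' where "{u. (y, u) \<in> E} = {y'}" using leaf yV by blast
    then have y': "{u. (y, u) \<in> E} = {x}" using sym_E[OF xy] by auto
    obtain z where z: "z \<in> inner" using assms(1) by blast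
    then have zV: "z \<in> V" "z \<noteq> x" "z \<noteq> y" using x \<open>y \<notin> inner\<close> by (auto simp: inner_def)
    obtain u where u: "(x, u) \<in> E" "d z x = Suc (d z u)" using d_step[OF zV(1) x(1) zV(2)] by blast
    obtain w where w: "(y, w) \<in> E" "d z y = Suc (d z w)" using d_step[OF zV(1) yV zV(3)] by blast
    have "u = y" "w = x" using u(1) w(1) y y' by auto
    then show False using u(2) w(2) by simp
  qed
  then show ?thesis using y by blast
qed

text \<open>Inner vertices are numbered by their distance from \<open>a\<close>, the leaves at each
  of them arbitrarily, and the entry at \<open>i\<close> is the degree of the inner vertex numbered
  \<open>i\<close>. The map \<open>f\<close> has the form that \<open>giso_iff\<close> asks
  for.\<close>

lemma caterpillar_iso:
  assumes inn: "inner = spine - {a, b}" and D: "D = Suc k" and k: "1 \<le> k"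
  shows "\<exists>\<phi> f. (\<forall>i\<in>{1..k}. \<exists>v\<in>inner. \<phi> i = deg v) \<and>
    bij_betw f V (pverts (caterpillar k \<phi>)) \<and>
    (\<forall>u\<in>V. \<forall>v\<in>V. (u, v) \<in> E \<longleftrightarrow> (f u, f v) \<in> parcs (caterpillar k \<phi>))"
proof -
  have inj_spine: "inj_on (d a) spine" using spine_bij by (simp add: bij_betw_def)
  have bij: "bij_betw (d a) inner {1..k}"
  proof -
    have "d a ` inner = d a ` spine - d a ` {a, b}"
      unfolding inn using inj_spine ends_spine by (intro inj_on_image_set_diff) auto
    also have "\<dots> = {1..k}"
      using spine_bij d_self[OF aV] D by (auto simp: bij_betw_def)
    finally show ?thesis
      using inj_spine inn by (auto simp: bij_betw_def intro: inj_on_subset)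
  qed
  then have inj: "inj_on (d a) inner" and im: "d a ` inner = {1..k}" by (auto simp: bij_betw_def)
  have innV: "inner \<subseteq> V" by (auto simp: inner_def)
  have inner_ne: "inner \<noteq> {}" using im k by auto
  have adj: "(u, v) \<in> E \<longleftrightarrow> d a v = Suc (d a u) \<or> d a u = Suc (d a v)"
    if uv: "u \<in> inner" "v \<in> inner" for u v
  proof -
    \<comment> \<open>The spine vertex \<open>v\<close> has a spine neighbour one step nearer to
      \<open>a\<close>; injectivity of the distance from \<open>a\<close> identifies it with
      \<open>u\<close>.\<close>
    have step: "(v, u) \<in> E" if "u \<in> inner" "v \<in> inner" "d a v = Suc (d a u)" for u v
    proof -
      have "v \<in> spine" "v \<noteq> a" "u \<in> spine" using that inn by auto
      then obtain w where "w \<in> spine" "(v, w) \<in> E" "d a v = Suc (d a w)" using spine_prev by blast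
      moreover have "w = u"
        using inj_onD[OF inj_spine, of w u] calculation \<open>u \<in> spine\<close> that(3) by simp
      ultimately show ?thesis by simp
    qed
    show ?thesis
      using edge_side[OF _ aV, of u v] step[OF uv] step[OF uv(2,1)] sym_E by blast
  qed
  define p where "p = the_inv_into inner (d a)"
  define \<phi> where "\<phi> i = deg (p i)" for i
  have p: "p i \<in> inner" "d a (p i) = i" if "i \<in> {1..k}" for i
    using that inj im the_inv_into_into[OF inj, of i inner] f_the_inv_into_f[OF inj, of i]
    unfolding p_def by auto
  have phi_d: "\<phi> (d a v) = deg v" if "v \<in> inner" for v
    using that the_inv_into_f_f[OF inj] by (simp add: \<phi>_def p_def)
  interpret cat: caterpillar_graph k \<phi>
    by unfold_locales (use k p(1) in \<open>auto simp: \<phi>_def inner_def\<close>)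
  define L where "L v = {x. (v, x) \<in> E \<and> x \<notin> inner}" for v
  have finL: "finite (L v)" for v
    by (rule finite_subset[OF _ finite_nbrs[of v]]) (auto simp: L_def)
  have da: "d a v \<in> {1..k}" if "v \<in> inner" for v using that im by blast
  have cardL: "card (L v) = cat.m (d a v)" if v: "v \<in> inner" for v
  proof -
    let ?N = "{u \<in> inner. (v, u) \<in> E}"
    have "d a ` ?N = {i \<in> {1..k}. i = Suc (d a v) \<or> d a v = Suc i}"
      unfolding im[symmetric] using adj[OF v] by auto
    also have "\<dots> = (if 1 < d a v then {d a v - 1} else {}) \<union> (if d a v < k then {Suc (d a v)} else {})"
      using da[OF v] by (auto split: if_splits)
    finally have "card (d a ` ?N) = (if 1 < d a v then 1 else 0) + (if d a v < k then 1 else 0)"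
      by (simp split: if_splits)
    then have "card ?N = (if 1 < d a v then 1 else 0) + (if d a v < k then 1 else 0)"
      using card_image[OF inj_on_subset[OF inj, of ?N]] by auto
    moreover have "deg v = card (L v) + card ?N"
    proof -
      have "{u. (v, u) \<in> E} = L v \<union> ?N" by (auto simp: L_def)
      moreover have "L v \<inter> ?N = {}" by (auto simp: L_def)
      ultimately show ?thesis
        unfolding deg_def using finL finite_inner by (simp add: card_Un_disjoint)
    qed
    ultimately show ?thesis
      using cat.phi_eq[OF da[OF v]] phi_d[OF v] by simp
  qed
  \<comment> \<open>The labels of the leaves start at 1 because label 0 marks the spine
    vertex.\<close>
  have "\<exists>h. bij_betw h (L v) {1..card (L v)}" for v
    using finL by (intro finite_same_card_bij) auto
  then obtain h where h: "\<And>v. bij_betw (h v) (L v) {1..card (L v)}" by metis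
  have h_im: "h v x \<in> {1..cat.m (d a v)}" if "v \<in> inner" "x \<in> L v" for v x
    using h[of v] that cardL by (auto simp: bij_betw_def)
  obtain par where par: "\<And>x. x \<in> V - inner \<Longrightarrow> {u. (x, u) \<in> E} = {par x} \<and> par x \<in> inner"
    using outer_neighbour[OF inner_ne] by (metis Diff_iff)
  have par_inner: "par x \<in> inner" and parL: "x \<in> L (par x)" if "x \<in> V - inner" for x
    using par[OF that] sym_E that by (auto simp: L_def)
  have L_par: "x \<in> V - inner \<and> par x = v" if "x \<in> L v" for x v
  proof -
    have "(v, x) \<in> E" "x \<notin> inner" using that by (auto simp: L_def)
    then have "(x, v) \<in> E" "x \<in> V - inner" using arcs sym_E by blast+
    then show ?thesis using par[of x] by (metis mem_Collect_eq singletonD)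
  qed
  define f where "f x = (if x \<in> inner then (d a x, 0) else (d a (par x), h (par x) x))" for x
  have f_in: "f x = (d a x, 0)" if "x \<in> inner" for x using that by (simp add: f_def)
  have f_out: "f x = (d a (par x), h (par x) x)" "h (par x) x \<in> {1..cat.m (d a (par x))}"
    if "x \<in> V - inner" for x
    using that h_im[OF par_inner[OF that] parL[OF that]] by (simp_all add: f_def)
  have inj_f: "inj_on f V"
  proof (rule inj_onI)
    fix x y assume xy: "x \<in> V" "y \<in> V" "f x = f y"
    consider "x \<in> inner" "y \<in> inner" | "x \<in> V - inner" "y \<in> V - inner"
      | "x \<in> inner \<longleftrightarrow> y \<notin> inner" using xy by blast
    then show "x = y"
    proof cases
      case 1
      then show ?thesis using xy inj f_in by (simp add: inj_on_def)
    next
      case 2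
      then have "d a (par x) = d a (par y)" "h (par x) x = h (par y) y" using xy f_out by auto
      moreover have "par x = par y" using calculation(1) 2 par_inner inj by (simp add: inj_on_def)
      ultimately show ?thesis
        using h[of "par x"] parL[OF 2(1)] parL[OF 2(2)] by (auto simp: bij_betw_def inj_on_def)
    next
      case 3
      then show ?thesis using xy f_in[of x] f_in[of y] f_out[of x] f_out[of y] by auto
    qed
  qed
  have "f ` V = pverts cat.C"
  proof (intro set_eqI iffI)
    fix y assume "y \<in> f ` V"
    then obtain x where x: "x \<in> V" "y = f x" by blast
    show "y \<in> pverts cat.C"
    proof (cases "x \<in> inner")
      case True
      then show ?thesis using x f_in da by (auto simp: cat.verts_Sigma)
    next
      case False
      then show ?thesis using x f_out[of x] da[OF par_inner[of x]] by (auto simp: cat.verts_Sigma)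
    qed
  next
    fix y assume "y \<in> pverts cat.C"
    then obtain i j where y: "y = (i, j)" "i \<in> {1..k}" "j \<le> cat.m i" by (auto simp: cat.verts_Sigma)
    show "y \<in> f ` V"
    proof (cases "j = 0")
      case True
      then have "y = f (p i)" using y p f_in by simp
      then show ?thesis using p(1) y innV by blast
    next
      case False
      then have "j \<in> {1..card (L (p i))}" using y p cardL[of "p i"] by simp
      then have "j \<in> h (p i) ` L (p i)" using h[of "p i"] by (simp add: bij_betw_def)
      then obtain x where x: "x \<in> L (p i)" "j = h (p i) x" by blast
      then have "y = f x" using L_par[OF x(1)] f_out(1)[of x] p(2)[of i] y by simp
      then show ?thesis using L_par[OF x(1)] by blast
    qed
  qed
  then have bij_f: "bij_betw f V (pverts cat.C)" using inj_f by (simp add: bij_betw_def)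
  have edge_out: "(x, u) \<in> E \<longleftrightarrow> u = par x" if "x \<in> V - inner" for x u
    using par[OF that] by blast
  have half: "(u, v) \<in> E \<longleftrightarrow> (f u, f v) \<in> parcs cat.C"
    if "u \<in> V" "v \<in> V - inner" for u v
  proof (cases "u \<in> inner")
    case True
    have "(u, v) \<in> E \<longleftrightarrow> u = par v" using edge_out[OF that(2)] sym_E by blast
    also have "\<dots> \<longleftrightarrow> d a u = d a (par v)" using True par_inner[OF that(2)] inj by (auto simp: inj_on_def)
    also have "\<dots> \<longleftrightarrow> (f u, f v) \<in> parcs cat.C"
      using f_in[OF True] f_out[OF that(2)] da[OF True] by (auto simp: cat.arc_iff)
    finally show ?thesis .
  next
    case False
    then have u: "u \<in> V - inner" using that by blast
    have "(u, v) \<notin> E" using edge_out[OF u, of v] par_inner[OF u] that(2) by auto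
    moreover have "(f u, f v) \<notin> parcs cat.C"
      using f_out[OF u] f_out[OF that(2)] by (auto simp: cat.arc_iff)
    ultimately show ?thesis by simp
  qed
  have symC: "(x, y) \<in> parcs cat.C \<longleftrightarrow> (y, x) \<in> parcs cat.C" for x y
    by (cases x; cases y) (auto simp: cat.arc_iff)
  have "(u, v) \<in> E \<longleftrightarrow> (f u, f v) \<in> parcs cat.C" if uv: "u \<in> V" "v \<in> V" for u v
  proof (cases "v \<in> inner")
    case False
    then show ?thesis using half uv by blast
  next
    case v: True
    show ?thesis
    proof (cases "u \<in> inner")
      case True
      then show ?thesis using adj[OF True v] f_in v da[OF v] da[OF True] by (auto simp: cat.arc_iff)
    next
      case False
      then have "(v, u) \<in> E \<longleftrightarrow> (f v, f u) \<in> parcs cat.C" using half uv by blast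
      then show ?thesis using symC sym_E by blast
    qed
  qed
  moreover have "\<forall>i\<in>{1..k}. \<exists>v\<in>inner. \<phi> i = deg v" using p(1) by (auto simp: \<phi>_def)
  ultimately show ?thesis using bij_f by blast
qed

end

section \<open>The extremal trees\<close>

text \<open>Of the \<open>n - r - 2\<close> entries above 1 the first \<open>r\<close> are 3, so
  \<open>\<sigma>\<close> maps the vertices with entry 3 bijectively onto \<open>{..<r}\<close>.
  Path eccentricities and \<open>spine_ecc\<close> differ by one, hence order the vertices
  alike.\<close>

lemma is_F_caterpillar:
  assumes "is_F n r F" "2 * r + 2 \<le> n"
  shows "\<exists>\<psi>. F = caterpillar (n - r - 2) \<psi> \<and> (\<forall>i\<in>{1..n - r - 2}. \<psi> i \<in> {2, 3}) \<and>
    card {i \<in> {1..n - r - 2}. \<psi> i = 3} = r \<and>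
    (\<forall>i\<in>{1..n - r - 2}. \<forall>i'\<in>{1..n - r - 2}.
      spine_ecc (n - r - 2) i' < spine_ecc (n - r - 2) i \<longrightarrow> \<psi> i' \<le> \<psi> i)"
proof -
  define k where "k = n - r - 2"
  have num: "num_inner (F_degrees n r) = k"
    using assms(2) by (simp add: num_inner_def F_degrees_def k_def)
  have nth: "F_degrees n r ! p = (if p < r then 3 else 2)" if "p < k" for p
    using that assms(2) by (auto simp: F_degrees_def nth_append k_def)
  obtain \<sigma> where \<sigma>: "greedy_assignment (F_degrees n r) \<sigma>"
    and F: "F = caterpillar k (\<lambda>i. F_degrees n r ! \<sigma> i)"
    using assms(1) unfolding is_F_def greedy_caterpillar_def num by blast
  define \<psi> where "\<psi> i = F_degrees n r ! \<sigma> i" for i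
  have bij: "bij_betw \<sigma> {1..k} {..<k}"
    and gr: "\<And>i j. i \<in> {1..k} \<Longrightarrow> j \<in> {1..k} \<Longrightarrow>
      ecc (path_graph k) j < ecc (path_graph k) i \<Longrightarrow> \<psi> j \<le> \<psi> i"
    using \<sigma> unfolding greedy_assignment_def num Let_def \<psi>_def by blast+
  have psi: "\<psi> i = (if \<sigma> i < r then 3 else 2)" if "i \<in> {1..k}" for i
    using nth[of "\<sigma> i"] bij_betwE[OF bij] that by (simp add: \<psi>_def)
  have im: "\<sigma> ` {i \<in> {1..k}. \<psi> i = 3} = {..<r}"
  proof -
    have "\<sigma> ` {i \<in> {1..k}. \<psi> i = 3} = {p \<in> \<sigma> ` {1..k}. p < r}"
      using psi by (auto split: if_splits)
    also have "\<dots> = {..<r}" using bij assms(2) by (auto simp: bij_betw_def k_def)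
    finally show ?thesis .
  qed
  have "inj_on \<sigma> {i \<in> {1..k}. \<psi> i = 3}"
    using bij by (auto simp: bij_betw_def intro: inj_on_subset)
  then have card: "card {i \<in> {1..k}. \<psi> i = 3} = r"
    using im card_image by fastforce
  have greedy: "\<psi> i' \<le> \<psi> i" if "i \<in> {1..k}" "i' \<in> {1..k}" "spine_ecc k i' < spine_ecc k i" for i i'
  proof -
    have "1 \<le> spine_ecc k i'" using that by (simp add: spine_ecc_def)
    then have "ecc (path_graph k) i' < ecc (path_graph k) i"
      using path_ecc[OF that(1)] path_ecc[OF that(2)] that(3) by linarith
    then show ?thesis by (rule gr[OF that(1,2)])
  qed
  have "F = caterpillar k \<psi>" using F by (simp add: \<psi>_def[abs_def])
  moreover have "\<forall>i\<in>{1..k}. \<psi> i \<in> {2, 3}" using psi by simp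
  ultimately show ?thesis using card greedy unfolding k_def by blast
qed

theorem theorem4p1:
  fixes n r :: nat
    and T :: "'a pair_pre_digraph"
    and F :: "(nat \<times> nat) pair_pre_digraph"
  assumes "1 \<le> r" and "real r \<le> real n / 2 - 1"
    and "undirected_tree T" and "card (pverts T) = n"
    and "card (branching_vertices T) = r"
    and "is_F n r F"
  shows "xi_ce T \<ge> xi_ce F \<and> (xi_ce T = xi_ce F \<longleftrightarrow> giso T F)"
proof -
  have rn: "2 * r + 2 \<le> n" using assms(2) by linarith
  \<comment> \<open>The number of inner vertices of \<open>F\<close>: \<open>r\<close> entries 3 and
    \<open>n - 2 * r - 2\<close> entries 2.\<close>
  define k where "k = n - r - 2"
  have k: "1 \<le> k" "r \<le> k" "n = k + r + 2" using rn assms(1) by (auto simp: k_def)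
  obtain \<psi> where F: "F = caterpillar k \<psi>" and psi: "\<And>i. i \<in> {1..k} \<Longrightarrow> \<psi> i \<in> {2, 3}"
    and three: "card {i \<in> {1..k}. \<psi> i = 3} = r"
    and greedy: "\<And>i i'. i \<in> {1..k} \<Longrightarrow> i' \<in> {1..k} \<Longrightarrow> spine_ecc k i' < spine_ecc k i \<Longrightarrow> \<psi> i' \<le> \<psi> i"
    using is_F_caterpillar[OF assms(6) rn] unfolding k_def by blast
  interpret F: caterpillar_graph k \<psi>
    by unfold_locales (use k psi in fastforce)+
  have card_F: "card (pverts F) = n"
  proof -
    have "\<psi> i = 2 + (if \<psi> i = 3 then 1 else 0)" if "i \<in> {1..k}" for i
      using psi[OF that] by auto
    then have "(\<Sum>i=1..k. \<psi> i) = (\<Sum>i=1..k. 2 + (if \<psi> i = 3 then 1 else 0))"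
      by (intro sum.cong) auto
    also have "\<dots> = 2 * k + r" using three by (simp only: sum.distrib) (simp add: sum.If_cases Int_def)
    finally show ?thesis using F.card_verts k by (simp add: F)
  qed

  \<comment> \<open>A diametral pair of the given tree\<close>
  interpret T: pair_graph T using assms(3) by (simp add: undirected_tree_def)
  have wfT: "pair_wf_digraph T" by (rule T.pair_wf_digraph)
  have mt: "metric_tree (pverts T) (parcs T) (gdist T)"
    by (rule undirected_tree_metric_tree[OF assms(3)])
  let ?P = "(\<lambda>(x, y). gdist T x y) ` (pverts T \<times> pverts T)"
  have P: "finite ?P" "?P \<noteq> {}" using metric_tree.finite_V[OF mt] metric_tree.V_ne[OF mt] by auto
  then obtain z where z: "z \<in> pverts T \<times> pverts T" "Max ?P = (\<lambda>(x, y). gdist T x y) z"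
    using Max_in[OF P] by blast
  obtain a b where "z = (a, b)" by fastforce
  with z have ab: "a \<in> pverts T" "b \<in> pverts T" "Max ?P = gdist T a b" by simp_all
  interpret diametral_tree "pverts T" "parcs T" "gdist T" a b
  proof (intro diametral_tree.intro diametral_tree_axioms.intro mt)
    fix x y assume "x \<in> pverts T" "y \<in> pverts T"
    then show "gdist T x y \<le> gdist T a b" unfolding ab(3)[symmetric] using P by (intro Max_ge) auto
  qed (use ab in auto)
  have deg: "deg v = gdegree T v" for v by (simp add: deg_def gdegree_card)
  have ec: "ec = ecc T" by (simp add: fun_eq_iff ec_def ecc_def)
  have lev: "level j = ecc_level T j" for j by (simp add: level_def ecc_level_def ec)
  have br: "card branching = r" using assms(5) by (simp add: branching_def branching_vertices_def deg)
  have cardV: "2 \<le> card (pverts T)" using k assms(4) by simp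
  have inner_le: "card inner \<le> k" using inner_bound(1)[OF cardV] br k assms(4) by simp
  have D_le: "D \<le> Suc k" using diameter_le inner_le by simp

  \<comment> \<open>Comparison of level sizes and level degrees\<close>
  have levels: "card (ecc_level F j) \<le> card (ecc_level T j)" if j: "1 \<le> j" for j
  proof (cases "D \<le> j")
    case True
    have "card (ecc_level F j) \<le> card (pverts F)"
      using F.finite_verts by (intro card_mono) (auto simp: F ecc_level_def)
    then show ?thesis using level_full[OF True] lev[of j] card_F assms(4) by simp
  next
    case False
    then have jk: "j \<le> k" using D_le by simp
    have "card (ecc_level F j) = (2 * j - k) + F.pendants_below j"
      using F.card_level spine_count_eq[OF jk] by (simp add: F)
    also have "\<dots> \<le> (2 * j - k) + (r + (2 * j - 2 - k) - k)"
      using pendants_below_greedy[OF F.caterpillar_graph_axioms psi three greedy j jk] by simp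
    \<comment> \<open>The bound of \<open>level_lower\<close> can only decrease when
      \<open>D\<close> is raised to \<open>Suc k\<close> and \<open>card inner\<close> to
      \<open>k\<close>.\<close>
    also have "\<dots> \<le> 2 * j + 1 - D + (card branching + (2 * j - 1 - D) - card inner)"
      using D_le inner_le br by linarith
    also have "\<dots> \<le> card (ecc_level T j)"
      using level_lower[of j] j False lev[of j] by simp
    finally show ?thesis .
  qed
  have F_deg: "level_degree F j + 2 \<le> card (ecc_level F j) + card (ecc_level F (Suc j))"
    if "1 \<le> spine_count k j" for j
    using F.level_degree_le[OF that] by (simp add: F)
  have T_deg: "card (ecc_level T j) + card (ecc_level T (Suc j)) \<le> level_degree T j + 2"
    if "1 \<le> j" "1 \<le> spine_count k j" for j
  proof -
    have "1 \<le> card (ecc_level F j)" using that F.card_level by (simp add: F)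
    then have "1 \<le> card (level j)" using levels[OF that(1)] lev by (metis order_trans)
    then have "level j \<noteq> {}" by auto
    then show ?thesis using level_deg_sum[of j] by (simp add: lev deg level_degree_def)
  qed
  \<comment> \<open>If no spine vertex of \<open>F\<close> has eccentricity at most
    \<open>j\<close>, the level degree of \<open>F\<close> is 0; otherwise the level of
    \<open>T\<close> is nonempty as well, and the two edge counts apply in opposite
    directions.\<close>
  have degrees: "level_degree F j \<le> level_degree T j" if j: "1 \<le> j" for j
  proof (cases "spine_count k j = 0")
    case True
    then show ?thesis using F.spine_count_0(2) by (simp add: F)
  next
    case False
    then have "1 \<le> spine_count k j" by simp
    then show ?thesis using F_deg T_deg[OF j] levels[OF j] levels[of "Suc j"] by fastforce
  qed
  have bound_T: "1 \<le> ecc T v \<and> ecc T v \<le> D" if v: "v \<in> pverts T" for v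
  proof
    have "\<not> pverts T \<subseteq> {v}" using card_mono[of "{v}" "pverts T"] cardV by auto
    then obtain w where "w \<in> pverts T" "w \<noteq> v" by blast
    then have "gdist T v w \<noteq> 0" using d_eq0 v by blast
    then show "1 \<le> ecc T v" using d_le_ec[OF v \<open>w \<in> pverts T\<close>] ec by simp
    show "ecc T v \<le> D" using ec_leI[OF v] diametral v ec by metis
  qed
  have bound_F: "1 \<le> ecc F v \<and> ecc F v \<le> Suc k" if "v \<in> pverts F" for v
    using F.ecc_bounds that by (simp add: F)
  have finF: "finite (pverts F)" using F.finite_verts by (simp add: F)
  note compare = xi_ce_compare[OF finite_V finF _ _ degrees]
  \<comment> \<open>\<open>D + k + 1\<close> bounds the eccentricities of both graphs, which are at
    most \<open>D\<close> and \<open>Suc k\<close>.\<close>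
  have ge: "xi_ce F \<le> xi_ce T"
    using compare(1)[of "D + k + 1"] bound_T bound_F by fastforce
  have giso_eq: "xi_ce T = xi_ce F" if "giso T F"
    using sum_with_ecc_giso[OF wfT F.wf, of "\<lambda>d e. real d / real e"] that
    by (simp add: xi_ce_def F)

  \<comment> \<open>The case of equality\<close>
  have "giso T F" if eq: "xi_ce T = xi_ce F"
  proof -
    have same_degree: "level_degree F j = level_degree T j" if "1 \<le> j" for j
    proof -
      \<comment> \<open>Adding \<open>j\<close> to the common bound places the index
        \<open>j\<close> strictly below it.\<close>
      have "\<And>v. v \<in> pverts T \<Longrightarrow> 1 \<le> ecc T v \<and> ecc T v \<le> D + k + 2 + j"
        "\<And>v. v \<in> pverts F \<Longrightarrow> 1 \<le> ecc F v \<and> ecc F v \<le> D + k + 2 + j"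
        using bound_T bound_F by fastforce+
      then show ?thesis using compare(2)[of "D + k + 2 + j" j] eq that by simp
    qed
    \<comment> \<open>With equal level degrees, two consecutive level sizes of \<open>T\<close> sum
      to at most the corresponding sum for \<open>F\<close>, while each is at least its
      counterpart.\<close>
    have same: "card (ecc_level F j) = card (ecc_level T j)" if "1 \<le> j" "1 \<le> spine_count k j" for j
      using F_deg[OF that(2)] T_deg[OF that] levels[OF that(1)] levels[of "Suc j"] same_degree[OF that(1)]
      by simp
    \<comment> \<open>Otherwise \<open>level k\<close> would contain all \<open>k + r + 2\<close>
      vertices of \<open>T\<close>, while the level of \<open>F\<close> has at most
      \<open>k + r\<close>.\<close>
    have D: "D = Suc k"
    proof (rule ccontr)
      assume "D \<noteq> Suc k"
      then have "level k = pverts T" using level_full[of k] D_le by simp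
      then have "card (ecc_level F k) = n"
        using same[of k] k spine_count_full[of k k] lev[of k] assms(4) by simp
      moreover have "card (ecc_level F k) = k + F.pendants_below k"
        using F.card_level spine_count_full[of k k] by (simp add: F)
      moreover have "F.pendants_below k \<le> r"
        using pendants_below_greedy[OF F.caterpillar_graph_axioms psi three greedy k(1) order_refl] k by simp
      ultimately show False using k by simp
    qed
    then have card_inner: "card inner = k" using diameter_le inner_le by simp
    then have inner: "inner = spine - {a, b}"
      using card_spine_interior D card_subset_eq[OF finite_inner spine_inner] by simp
    obtain \<phi> f where phi: "\<And>i. i \<in> {1..k} \<Longrightarrow> \<exists>v\<in>inner. \<phi> i = deg v"
      and f: "bij_betw f (pverts T) (pverts (caterpillar k \<phi>))"
        "\<forall>u\<in>pverts T. \<forall>v\<in>pverts T. (u, v) \<in> parcs T \<longleftrightarrow> (f u, f v) \<in> parcs (caterpillar k \<phi>)"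
      using caterpillar_iso[OF inner D k(1)] by blast
    \<comment> \<open>The number of vertices is the least that \<open>inner_bound\<close> permits,
      and then no degree exceeds 3.\<close>
    have phi23: "\<phi> i \<in> {2, 3}" if i: "i \<in> {1..k}" for i
    proof -
      obtain v where v: "v \<in> inner" "\<phi> i = deg v" using phi[OF i] by blast
      then have "v \<in> pverts T" "2 \<le> deg v" by (auto simp: local.inner_def)
      moreover have "deg v \<le> 3"
        using inner_bound(2)[OF cardV] card_inner br k assms(4) calculation by simp
      ultimately show ?thesis using v by auto
    qed
    interpret C: caterpillar_graph k \<phi>
      by unfold_locales (use k phi23 in fastforce)+
    have TC: "giso T C.C" unfolding giso_iff[OF wfT C.wf] using f by blast
    \<comment> \<open>Both caterpillars have the same spine counts, so equal level sizes leave equal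
      numbers of pendant vertices.\<close>
    have "C.pendants_below j = F.pendants_below j" if "1 \<le> j" for j
    proof (cases "spine_count k j = 0")
      case True
      then show ?thesis using C.spine_count_0(1) F.spine_count_0(1) by simp
    next
      case False
      then have "card (ecc_level F j) = card (ecc_level T j)" using same that by simp
      also have "\<dots> = card (ecc_level C.C j)"
        using giso_card_ecc_level[OF wfT C.wf TC finite_V C.finite_verts] .
      finally show ?thesis using C.card_level F.card_level by (simp add: F)
    qed
    then have "\<phi> i + \<phi> (k + 1 - i) = \<psi> i + \<psi> (k + 1 - i)" if "i \<in> {1..k}" for i
      using pendants_below_pairs[OF C.caterpillar_graph_axioms F.caterpillar_graph_axioms _ that] by blast
    from phi_unique_up_to_rev[of k \<phi> \<psi>, OF phi23 psi greedy this]
    show ?thesis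
    proof
      assume "\<forall>i\<in>{1..k}. \<phi> i = \<psi> i"
      then have "C.C = F" unfolding F by (intro caterpillar_cong) auto
      then show ?thesis using TC by simp
    next
      assume "\<forall>i\<in>{1..k}. \<phi> i = \<psi> (k + 1 - i)"
      then have "giso C.C F" unfolding F
        by (intro giso_caterpillar_rev C.caterpillar_graph_axioms F.caterpillar_graph_axioms) auto
      then show ?thesis using TC digraph_iso_trans by blast
    qed
  qed
  then show ?thesis using ge giso_eq by blast
qed

end
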